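(* Let $\Omega\subset\mathbb{R}^n$ be a bounded domain and let $\varphi\in\Phi_w(\Omega)$ satisfy (A0) and (Dec). (1) Let $r>1$ and $u_0\in L^{1,\varphi^r}(\Omega)$. Then $E_p$ $\Gamma$-converges to $E$ in the topology of $L^1(\Omega)$ as $p\to1^+$. (2) Let $f\in L^2(\Omega)$. If $C^\infty(\overline\Omega)$ is dense in $L^{1,\varphi}(\Omega)\cap L^2(\Omega)$ (with respect to the norm $\|u\|_{L^{1,\varphi}(\Omega)}+\|u\|_{L^2(\Omega)}$), then $F_p$ $\Gamma$-converges to $F$ in the topology of $L^2(\Omega)$ as $p\to1^+$.
   Context: $\Omega\subset\mathbb{R}^n$ is a bounded domain (bounded, open, connected). A function $g$ on $(0,\infty)$ is $L$-almost increasing ($L\ge1$) if $g(s)\le Lg(t)$ whenever $0<s\le t$, and $L$-almost decreasing if $g(t)\le Lg(s)$ whenever $0<s\le t$. A weak $\Phi$-function, written $\varphi\in\Phi_w(\Omega)$, is a function $\varphi:\Omega\times[0,\infty)\to[0,\infty]$ such that for a.e. $x\in\Omega$: for every measurable $h:\Omega\to\mathbb{R}$ the function $y\mapsto\varphi(y,h(y))$ is measurable; $t\mapsto\varphi(x,t)$ is non-decreasing; $\varphi(x,0)=\lim_{t\to0^+}\varphi(x,t)=0$ and $\lim_{t\to\infty}\varphi(x,t)=\infty$; and $t\mapsto\varphi(x,t)/t$ is $L$-almost increasing on $(0,\infty)$ with $L$ independent of $x$. (A0): there is $\beta\in(0,1]$ with $\varphi(x,\beta)\le1\le\varphi(x,1/\beta)$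 for a.e. $x$. (Dec)$_q$: $t\mapsto\varphi(x,t)/t^q$ is decreasing on $(0,\infty)$ for a.e. $x$; (Dec) means (Dec)$_q$ holds for some $q\in(1,\infty)$. For measurable $u$, $\varrho_\varphi(u)=\int_\Omega\varphi(x,|u|)\,dx$; $L^\varphi(\Omega)$ is the set of measurable $u$ with $\varrho_\varphi(\lambda u)<\infty$ for some $\lambda>0$, with $\|u\|_\varphi=\inf\{\lambda>0:\varrho_\varphi(u/\lambda)\le1\}$, and $\|v\|_\varphi:=\||v|\|_\varphi$ for vector-valued $v$. $L^{1,\varphi}(\Omega)=\{u\in W^{1,1}(\Omega):\|u\|_{L^{1,\varphi}(\Omega)}<\infty\}$ where $\|u\|_{L^{1,\varphi}(\Omega)}=\|u\|_{L^1(\Omega)}+\|\nabla u\|_\varphi$. $L^{1,\varphi}_0(\Omega)$ is the set of $u\in L^{1,\varphi}(\Omega)$ for which there are $\xi_i\in C_0^\infty(\Omega)$ with $\xi_i\to u$ in $L^{1,\varphi}(\Omega)$. For $p\ge1$, $\varphi^p(x,t):=\varphi(x,t)^p$. Functionals with boundary values: given $r>1$, $u_0\in L^{1,\varphi^r}(\Omega)$, for $p\in(1,r)$, $E_p:L^1(\Omega)\to[0,\infty]$, $E_p(u)=\int_\Omega\varphi(x,|\nabla u|)^p\,dx$ if $u-u_0\in L^{1,\varphi^p}_0(\Omega)$ and $E_p(u)=+\infty$ otherwise; $E:L^1(\Omega)\to[0,\infty]$, $E(u)=\inf\{\liminf_{i\to\infty}\int_\Omega\varphi(x,|\nabla u_i|)\,dx: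 u_i-u_0\in L^{1,\varphi}_0(\Omega),\ u_i\to u\text{ in }L^1(\Omega)\}$. Functionals with fidelity term: given $f\in L^2(\Omega)$, for $p>1$, $F_p:L^2(\Omega)\to[0,\infty]$, $F_p(u)=\int_\Omega\varphi(x,|\nabla u|)^p+|u-f|^2\,dx$ if $u\in L^{1,\varphi^p}(\Omega)\cap L^2(\Omega)$ and $+\infty$ otherwise; $F:L^2(\Omega)\to[0,\infty]$, $F(u)=\inf\{\liminf_{i\to\infty}\int_\Omega\varphi(x,|\nabla u_i|)+|u_i-f|^2\,dx: u_i\in L^{1,\varphi}(\Omega)\cap L^2(\Omega),\ u_i\to u\text{ in }L^2(\Omega)\}$. $\Gamma$-convergence of $G_p$ to $G$ on a space $X$ with topology $\tau$ as $p\to1^+$ means: for every sequence $p_i\to1^+$, (a) $G(u)\le\liminf_i G_{p_i}(u_i)$ for every $u\in X$ and every sequence $u_i\to u$ in $\tau$, and (b) for every $u\in X$ there is a sequence $u_i\to u$ in $\tau$ with $G(u)\ge\limsup_i G_{p_i}(u_i)$. *)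

theory Defs
  imports "HOL-Analysis.Analysis"
begin

definition pderiv :: "'n::finite \<Rightarrow> (real^'n \<Rightarrow> real) \<Rightarrow> real^'n \<Rightarrow> real" where
  "pderiv i f x = frechet_derivative f (at x) (axis i 1)"

coinductive smooth :: "(real^'n::finite \<Rightarrow> real) \<Rightarrow> bool" where
  "(\<forall>x. f differentiable (at x)) \<Longrightarrow> (\<forall>i. smooth (pderiv i f)) \<Longrightarrow> smooth f"

definition test_fun :: "(real^'n::finite) set \<Rightarrow> (real^'n \<Rightarrow> real) \<Rightarrow> bool" where
  "test_fun \<Omega> \<xi> \<longleftrightarrow> smooth \<xi> \<and> compact (closure {x. \<xi> x \<noteq> 0}) \<and> closure {x. \<xi> x \<noteq> 0} \<subseteq> \<Omega>"

definition smooth_closure :: "(real^'n::finite) set \<Rightarrow> (real^'n \<Rightarrow> real) \<Rightarrow> bool" where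
  "smooth_closure \<Omega> v \<longleftrightarrow> (\<exists>w. smooth w \<and> (\<forall>x\<in>closure \<Omega>. v x = w x))"

definition L1 :: "(real^'n::finite) set \<Rightarrow> (real^'n \<Rightarrow> real) \<Rightarrow> bool" where
  "L1 \<Omega> u \<longleftrightarrow> u \<in> borel_measurable (lebesgue_on \<Omega>) \<and> integrable (lebesgue_on \<Omega>) u"

definition L2 :: "(real^'n::finite) set \<Rightarrow> (real^'n \<Rightarrow> real) \<Rightarrow> bool" where
  "L2 \<Omega> u \<longleftrightarrow> u \<in> borel_measurable (lebesgue_on \<Omega>) \<and> integrable (lebesgue_on \<Omega>) (\<lambda>x. (u x)\<^sup>2)"

definition L1_norm :: "(real^'n::finite) set \<Rightarrow> (real^'n \<Rightarrow> real) \<Rightarrow> ennreal" where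
  "L1_norm \<Omega> u = (\<integral>\<^sup>+ x. ennreal \<bar>u x\<bar> \<partial>(lebesgue_on \<Omega>))"

definition ennpow :: "ennreal \<Rightarrow> real \<Rightarrow> ennreal" where
  "ennpow a p = (if a = \<infinity> then \<infinity> else ennreal (enn2real a powr p))"

definition L2_norm :: "(real^'n::finite) set \<Rightarrow> (real^'n \<Rightarrow> real) \<Rightarrow> ennreal" where
  "L2_norm \<Omega> u = ennpow (\<integral>\<^sup>+ x. ennreal ((u x)\<^sup>2) \<partial>(lebesgue_on \<Omega>)) (1/2)"

definition weak_grad :: "(real^'n::finite) set \<Rightarrow> (real^'n \<Rightarrow> real) \<Rightarrow> (real^'n \<Rightarrow> real^'n) \<Rightarrow> bool" where
  "weak_grad \<Omega> u g \<longleftrightarrow> L1 \<Omega> u \<and> (\<forall>i. L1 \<Omega> (\<lambda>x. g x $ i)) \<and>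
     (\<forall>\<xi> i. test_fun \<Omega> \<xi> \<longrightarrow>
        (\<integral>x. u x * pderiv i \<xi> x \<partial>(lebesgue_on \<Omega>)) = - (\<integral>x. g x $ i * \<xi> x \<partial>(lebesgue_on \<Omega>)))"

definition W11 :: "(real^'n::finite) set \<Rightarrow> (real^'n \<Rightarrow> real) \<Rightarrow> bool" where
  "W11 \<Omega> u \<longleftrightarrow> (\<exists>g. weak_grad \<Omega> u g)"

definition wgrad :: "(real^'n::finite) set \<Rightarrow> (real^'n \<Rightarrow> real) \<Rightarrow> real^'n \<Rightarrow> real^'n" where
  "wgrad \<Omega> u = (SOME g. weak_grad \<Omega> u g)"

type_synonym 'n phi = "real^'n \<Rightarrow> real \<Rightarrow> ennreal"

definition almost_increasing :: "real \<Rightarrow> (real \<Rightarrow> ennreal) \<Rightarrow> bool" where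
  "almost_increasing L g \<longleftrightarrow> (\<forall>s t. 0 < s \<and> s \<le> t \<longrightarrow> g s \<le> ennreal L * g t)"

definition weak_Phi :: "(real^'n::finite) set \<Rightarrow> 'n phi \<Rightarrow> bool" where
  "weak_Phi \<Omega> \<phi> \<longleftrightarrow>
     (\<forall>h. h \<in> borel_measurable (lebesgue_on \<Omega>) \<and> (\<forall>y. 0 \<le> h y) \<longrightarrow>
        (\<lambda>y. \<phi> y (h y)) \<in> borel_measurable (lebesgue_on \<Omega>)) \<and>
     (\<exists>L\<ge>1. AE x in lebesgue_on \<Omega>.
        mono_on {0..} (\<phi> x) \<and> \<phi> x 0 = 0 \<and> (\<phi> x \<longlongrightarrow> 0) (at_right 0) \<and>
        (\<phi> x \<longlongrightarrow> \<infinity>) at_top \<and>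
        almost_increasing L (\<lambda>t. \<phi> x t / ennreal t))"

definition A0 :: "(real^'n::finite) set \<Rightarrow> 'n phi \<Rightarrow> bool" where
  "A0 \<Omega> \<phi> \<longleftrightarrow> (\<exists>\<beta>. 0 < \<beta> \<and> \<beta> \<le> 1 \<and>
     (AE x in lebesgue_on \<Omega>. \<phi> x \<beta> \<le> 1 \<and> 1 \<le> \<phi> x (1 / \<beta>)))"

definition Dec :: "(real^'n::finite) set \<Rightarrow> 'n phi \<Rightarrow> bool" where
  "Dec \<Omega> \<phi> \<longleftrightarrow> (\<exists>q>1. AE x in lebesgue_on \<Omega>.
     (\<forall>s t. 0 < s \<and> s \<le> t \<longrightarrow> \<phi> x t / ennreal (t powr q) \<le> \<phi> x s / ennreal (s powr q)))"

definition phi_pow :: "'n phi \<Rightarrow> real \<Rightarrow> 'n phi" where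
  "phi_pow \<phi> p = (\<lambda>x t. ennpow (\<phi> x t) p)"

definition modular :: "(real^'n::finite) set \<Rightarrow> 'n phi \<Rightarrow> (real^'n \<Rightarrow> real^'n) \<Rightarrow> ennreal" where
  "modular \<Omega> \<phi> v = (\<integral>\<^sup>+ x. \<phi> x (norm (v x)) \<partial>(lebesgue_on \<Omega>))"

definition phi_norm :: "(real^'n::finite) set \<Rightarrow> 'n phi \<Rightarrow> (real^'n \<Rightarrow> real^'n) \<Rightarrow> ennreal" where
  "phi_norm \<Omega> \<phi> v = Inf {ennreal lam | lam. lam > 0 \<and> modular \<Omega> \<phi> (\<lambda>x. v x /\<^sub>R lam) \<le> 1}"

definition L1phi_norm :: "(real^'n::finite) set \<Rightarrow> 'n phi \<Rightarrow> (real^'n \<Rightarrow> real) \<Rightarrow> ennreal" where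
  "L1phi_norm \<Omega> \<phi> u = (if W11 \<Omega> u then L1_norm \<Omega> u + phi_norm \<Omega> \<phi> (wgrad \<Omega> u) else \<infinity>)"

definition L1phi :: "(real^'n::finite) set \<Rightarrow> 'n phi \<Rightarrow> (real^'n \<Rightarrow> real) \<Rightarrow> bool" where
  "L1phi \<Omega> \<phi> u \<longleftrightarrow> W11 \<Omega> u \<and> L1phi_norm \<Omega> \<phi> u < \<infinity>"

definition L1phi0 :: "(real^'n::finite) set \<Rightarrow> 'n phi \<Rightarrow> (real^'n \<Rightarrow> real) \<Rightarrow> bool" where
  "L1phi0 \<Omega> \<phi> u \<longleftrightarrow> L1phi \<Omega> \<phi> u \<and>
     (\<exists>\<xi>. (\<forall>i. test_fun \<Omega> (\<xi> i)) \<and> (\<lambda>i. L1phi_norm \<Omega> \<phi> (\<lambda>x. \<xi> i x - u x)) \<longlonglongrightarrow> 0)"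

definition E_p :: "(real^'n::finite) set \<Rightarrow> 'n phi \<Rightarrow> (real^'n \<Rightarrow> real) \<Rightarrow> real \<Rightarrow> (real^'n \<Rightarrow> real) \<Rightarrow> ennreal" where
  "E_p \<Omega> \<phi> u0 p u = (if L1phi0 \<Omega> (phi_pow \<phi> p) (\<lambda>x. u x - u0 x)
      then \<integral>\<^sup>+ x. ennpow (\<phi> x (norm (wgrad \<Omega> u x))) p \<partial>(lebesgue_on \<Omega>) else \<infinity>)"

definition E_lim :: "(real^'n::finite) set \<Rightarrow> 'n phi \<Rightarrow> (real^'n \<Rightarrow> real) \<Rightarrow> (real^'n \<Rightarrow> real) \<Rightarrow> ennreal" where
  "E_lim \<Omega> \<phi> u0 u = Inf {liminf (\<lambda>i. \<integral>\<^sup>+ x. \<phi> x (norm (wgrad \<Omega> (us i) x)) \<partial>(lebesgue_on \<Omega>)) | us.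
      (\<forall>i. L1phi0 \<Omega> \<phi> (\<lambda>x. us i x - u0 x)) \<and> (\<forall>i. L1 \<Omega> (us i)) \<and>
      (\<lambda>i. L1_norm \<Omega> (\<lambda>x. us i x - u x)) \<longlonglongrightarrow> 0}"

definition F_p :: "(real^'n::finite) set \<Rightarrow> 'n phi \<Rightarrow> (real^'n \<Rightarrow> real) \<Rightarrow> real \<Rightarrow> (real^'n \<Rightarrow> real) \<Rightarrow> ennreal" where
  "F_p \<Omega> \<phi> f p u = (if L1phi \<Omega> (phi_pow \<phi> p) u \<and> L2 \<Omega> u
      then \<integral>\<^sup>+ x. ennpow (\<phi> x (norm (wgrad \<Omega> u x))) p + ennreal ((u x - f x)\<^sup>2) \<partial>(lebesgue_on \<Omega>)
      else \<infinity>)"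

definition F_lim :: "(real^'n::finite) set \<Rightarrow> 'n phi \<Rightarrow> (real^'n \<Rightarrow> real) \<Rightarrow> (real^'n \<Rightarrow> real) \<Rightarrow> ennreal" where
  "F_lim \<Omega> \<phi> f u = Inf {liminf (\<lambda>i. \<integral>\<^sup>+ x. \<phi> x (norm (wgrad \<Omega> (us i) x)) + ennreal ((us i x - f x)\<^sup>2) \<partial>(lebesgue_on \<Omega>)) | us.
      (\<forall>i. L1phi \<Omega> \<phi> (us i) \<and> L2 \<Omega> (us i)) \<and>
      (\<lambda>i. L2_norm \<Omega> (\<lambda>x. us i x - u x)) \<longlonglongrightarrow> 0}"

definition Gamma_conv :: "real set \<Rightarrow> ('a \<Rightarrow> bool) \<Rightarrow> ((nat \<Rightarrow> 'a) \<Rightarrow> 'a \<Rightarrow> bool)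
    \<Rightarrow> (real \<Rightarrow> 'a \<Rightarrow> ennreal) \<Rightarrow> ('a \<Rightarrow> ennreal) \<Rightarrow> bool" where
  "Gamma_conv P X conv Gp G \<longleftrightarrow>
     (\<forall>ps. (\<forall>i. ps i \<in> P) \<and> ps \<longlonglongrightarrow> 1 \<longrightarrow>
        (\<forall>u us. X u \<and> (\<forall>i. X (us i)) \<and> conv us u \<longrightarrow> G u \<le> liminf (\<lambda>i. Gp (ps i) (us i))) \<and>
        (\<forall>u. X u \<longrightarrow> (\<exists>us. (\<forall>i. X (us i)) \<and> conv us u \<and> limsup (\<lambda>i. Gp (ps i) (us i)) \<le> G u)))"

end

theory Submission
  imports Defs
begin

text \<open>
  Both \<open>\<Gamma>\<close>-limits rest on two pointwise inequalities for \<open>a \<ge> 0\<close> and \<open>1 < p < r\<close>: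
  \<open>a \<le> a\<^sup>p + (p - 1)\<close> and \<open>a\<^sup>p \<le> a + \<theta> a\<^sup>r\<close> with \<open>\<theta> = (p - 1) / (r - 1)\<close>.
  Since \<open>\<Omega>\<close> has finite measure, the first one bounds the \<open>\<phi>\<close>-energy along a sequence by its
  \<open>\<phi>\<^sup>p\<close>-energies up to a vanishing error, so that (a subsequence of) the sequence itself
  competes in the relaxed functional. The second one shows that the \<open>\<phi>\<^sup>p\<close>-energy of a fixed
  function with finite \<open>\<phi>\<^sup>r\<close>-energy converges to its \<open>\<phi>\<close>-energy as \<open>p \<rightarrow> 1\<close>. Such functions,
  namely \<open>u\<^sub>0 + \<xi>\<close> with a test function \<open>\<xi>\<close>, respectively functions smooth up to the boundary,
  approximate the competitors of the relaxed functional; a diagonal argument then gives recovery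
  sequences. The approximation is continuous in energy although \<open>\<phi>\<close> need not be convex, because (Dec)
  yields \<open>\<phi>(a + b) \<le> (1 + \<delta>)\<^sup>q \<phi>(a) + (1 + 1 / \<delta>)\<^sup>q \<phi>(b)\<close> for every \<open>\<delta> > 0\<close>.
\<close>

subsection \<open>Bump functions and the fundamental lemma of the calculus of variations\<close>

text \<open>\<open>wgrad\<close> is an arbitrary choice among weak gradients, so its value on a sum
  or on a smooth function is not known by definition. Hence a.e. uniqueness, which requires explicit
  test functions, and integration by parts come first. The next obstacle is admissibility: a finite
  value of \<open>E_p\<close> places \<open>u - u0\<close> in the closure of the test functions for
  the \<open>\<phi>^p\<close> norm, while the relaxed functional asks for the \<open>\<phi>\<close>
  norm. Norms, not only energies, must therefore be compared, and without convexity the link between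
  norm and modular is made by the constants of \<open>doubling\<close>. For the upper bound, a
  competitor of the relaxed functional may have infinite \<open>\<phi>^p\<close>-energy for every
  \<open>p > 1\<close>, so it cannot be inserted into \<open>E_p\<close> or \<open>F_p\<close>
  directly. It is replaced by one nearby function that is admissible for all relevant
  \<open>p\<close> at once; the assumption on \<open>u0\<close>, respectively the density of smooth
  functions, provides it. Only upper bounds on perturbed energies are required, since the energy of
  the replacement merely has to stay close to the infimum from above.\<close>

lemma pderiv_eqI:
  "(f has_derivative f') (at x) \<Longrightarrow> pderiv i f x = f' (axis i 1)"
  unfolding pderiv_def by (metis frechet_derivative_at)

text \<open>The classical function \<open>exp (-1/t)\<close>, extended by zero, together with its
  quotients by powers of \<open>t\<close>. The powers are included because differentiation sends
  \<open>flat k\<close> to a combination of \<open>flat (k + 1)\<close> and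
  \<open>flat (k + 2)\<close>, so the family needs no further members.\<close>

definition flat :: "nat \<Rightarrow> real \<Rightarrow> real" where
  "flat k t = (if t > 0 then exp (- (1 / t)) / t ^ k else 0)"

text \<open>Exponential decay beats every pole: with \<open>s = 1/t\<close> the limit from the right
  is that of \<open>s^k / exp s\<close> at infinity.\<close>

lemma flat_tendsto_0: "(flat k \<longlongrightarrow> 0) (at 0)"
proof -
  have "((\<lambda>t::real. inverse t ^ k / exp (inverse t)) \<longlongrightarrow> 0) (at_right 0)"
    using filterlim_compose[OF tendsto_power_div_exp_0 filterlim_inverse_at_top_right] .
  then have "(flat k \<longlongrightarrow> 0) (at_right 0)"
    by (rule Lim_transform_eventually)
      (auto simp: eventually_at_right_less flat_def exp_minus field_simps
        intro!: eventually_mono[OF eventually_at_right_less[of 0]])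
  moreover have "(flat k \<longlongrightarrow> 0) (at_left 0)"
    by (rule tendsto_eventually) (auto simp: eventually_at_filter flat_def)
  ultimately show ?thesis
    by (simp add: filterlim_at_split)
qed

lemma DERIV_flat:
  "(flat k has_real_derivative flat (k + 2) t - real k * flat (k + 1) t) (at t)"
proof (cases t "0::real" rule: linorder_cases)
  case less
  have "((\<lambda>_. 0) has_real_derivative flat (k + 2) t - real k * flat (k + 1) t) (at t)"
    using less by (auto simp: flat_def intro!: derivative_eq_intros)
  then show ?thesis
    by (rule has_field_derivative_transform_within_open[of _ _ _ "{..<0}"])
      (use less in \<open>auto simp: flat_def\<close>)
next
  case equal
  \<comment> \<open>The difference quotient of \<open>flat k\<close> at the origin is exactly
    \<open>flat (k + 1)\<close>, so differentiability there is again the limit just proved.\<close>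
  have "((\<lambda>y. (flat k y - flat k 0) / (y - 0)) \<longlongrightarrow> 0) (at 0)"
    by (rule Lim_transform_eventually[OF flat_tendsto_0[of "k + 1"]])
      (auto simp: eventually_at_filter flat_def)
  then show ?thesis
    using equal by (simp add: has_field_derivative_iff flat_def)
next
  case greater
  have "((\<lambda>s. exp (- (1 / s)) / s ^ k) has_real_derivative
      flat (k + 2) t - real k * flat (k + 1) t) (at t)"
    using greater
    apply (auto simp: flat_def power2_eq_square intro!: derivative_eq_intros)
    apply (cases k)
    apply (auto simp: field_simps)
    done
  then show ?thesis
    by (rule has_field_derivative_transform_within_open[of _ _ _ "{0<..}"])
      (use greater in \<open>auto simp: flat_def\<close>)
qed

text \<open>A class of functions closed under partial derivatives, so that smoothness follows by coinduction.\<close>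

inductive flat_alg :: "(real^'n::finite \<Rightarrow> real) \<Rightarrow> bool" where
  const: "flat_alg (\<lambda>x. c)"
| flat: "flat_alg (\<lambda>x. flat k (c * x $ j + d))"
| add: "flat_alg f \<Longrightarrow> flat_alg g \<Longrightarrow> flat_alg (\<lambda>x. f x + g x)"
| mult: "flat_alg f \<Longrightarrow> flat_alg g \<Longrightarrow> flat_alg (\<lambda>x. f x * g x)"

lemma flat_alg_pderiv:
  fixes f :: "real^'n::finite \<Rightarrow> real"
  assumes "flat_alg f"
  shows "(\<forall>x. f differentiable (at x)) \<and> (\<forall>i. flat_alg (pderiv i f))"
  using assms
proof induction
  case (const c)
  have "pderiv i (\<lambda>x. c) = (\<lambda>x::real^'n. 0)" for i
    by (rule ext, rule pderiv_eqI) (auto intro!: derivative_eq_intros)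
  then show ?case by (auto intro: flat_alg.const)
next
  case (flat k c j d)
  have D: "((\<lambda>x. flat k (c * x $ j + d)) has_derivative
      (\<lambda>h. (flat (k + 2) (c * x $ j + d) - real k * flat (k + 1) (c * x $ j + d)) * (c * h $ j)))
      (at x)" for x :: "real^'n"
  proof -
    have "((\<lambda>x. c * x $ j + d) has_derivative (\<lambda>h. c * h $ j)) (at x)"
      by (auto intro!: derivative_eq_intros bounded_linear_imp_has_derivative bounded_linear_vec_nth)
    from DERIV_compose_FDERIV[OF DERIV_flat this]
    show ?thesis by (simp add: mult.commute)
  qed
  have "pderiv i (\<lambda>x. flat k (c * x $ j + d)) = (\<lambda>x.
     (flat (k + 2) (c * x $ j + d) + - real k * flat (k + 1) (c * x $ j + d))
       * (c * axis i 1 $ j))" for i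
    by (rule ext, subst pderiv_eqI[OF D]) simp
  moreover have "flat_alg (\<lambda>x. (flat (k + 2) (c * x $ j + d) + - real k * flat (k + 1) (c * x $ j + d))
       * (c * axis i 1 $ j))" for i
    by (intro flat_alg.intros)
  ultimately show ?case
    using D unfolding differentiable_def by auto
next
  case (add f g)
  have "pderiv i (\<lambda>x. f x + g x) = (\<lambda>x. pderiv i f x + pderiv i g x)" for i
    by (rule ext, rule trans[OF pderiv_eqI[OF has_derivative_add]])
      (use add in \<open>auto simp: frechet_derivative_works[symmetric] pderiv_def\<close>)
  then show ?case using add by (auto intro!: flat_alg.add)
next
  case (mult f g)
  have "pderiv i (\<lambda>x. f x * g x) = (\<lambda>x. f x * pderiv i g x + pderiv i f x * g x)" for i
    by (rule ext, rule trans[OF pderiv_eqI[OF has_derivative_mult]])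
      (use mult in \<open>auto simp: frechet_derivative_works[symmetric] pderiv_def\<close>)
  then show ?case using mult by (auto intro!: flat_alg.intros)
qed

lemma smooth_flat_alg: "flat_alg f \<Longrightarrow> smooth f"
  by (coinduction arbitrary: f rule: smooth.coinduct) (use flat_alg_pderiv in blast)

lemma flat_alg_prod:
  "(\<And>i. i \<in> I \<Longrightarrow> flat_alg (f i)) \<Longrightarrow> flat_alg (\<lambda>x. \<Prod>i\<in>I. f i x)"
  by (induction I rule: infinite_finite_induct) (auto intro: flat_alg.intros)

lemma flat_0_bounds: "0 \<le> flat 0 t" "flat 0 t \<le> 1"
  by (auto simp: flat_def)

lemma flat_0_scale_tendsto: "(\<lambda>k. flat 0 (real (Suc k) * t)) \<longlonglongrightarrow> (if t > 0 then 1 else 0)"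
proof (cases "t > 0")
  case True
  have "(\<lambda>k. 1 / (real (Suc k) * t)) \<longlonglongrightarrow> 0"
    using tendsto_mult_right_zero[OF LIMSEQ_inverse_real_of_nat, of "1 / t"]
    by (simp add: field_simps)
  from tendsto_exp[OF tendsto_minus[OF this]]
  have "(\<lambda>k. exp (- (1 / (real (Suc k) * t)))) \<longlonglongrightarrow> 1"
    by simp
  moreover have "real (Suc k) * t > 0" for k
    using True by simp
  ultimately show ?thesis
    using True unfolding flat_def by simp
next
  case False
  then have "\<not> real (Suc k) * t > 0" for k
    by (simp add: not_less mult_nonneg_nonpos)
  with False show ?thesis unfolding flat_def by simp
qed

text \<open>Each coordinate contributes one factor per face of the box, which makes the function
  positive exactly inside the open box when \<open>c > 0\<close>. The steepness \<open>c\<close> is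
  a parameter because the bumps tend to the indicator of the open box as it grows.\<close>

definition box_bump :: "real^'n::finite \<Rightarrow> real^'n \<Rightarrow> real \<Rightarrow> real^'n \<Rightarrow> real" where
  "box_bump a b c x = (\<Prod>i\<in>UNIV. flat 0 (c * (x $ i - a $ i)) * flat 0 (c * (b $ i - x $ i)))"

lemma smooth_box_bump:
  fixes a b :: "real^'n::finite"
  shows "smooth (box_bump a b c)"
proof -
  have "flat_alg (\<lambda>x. flat 0 (c * x $ i + - (c * a $ i)) * flat 0 (- c * x $ i + c * b $ i))" for i
    by (intro flat_alg.intros)
  moreover have "c * x $ i + - (c * a $ i) = c * (x $ i - a $ i)"
    "- c * x $ i + c * b $ i = c * (b $ i - x $ i)" for x :: "real^'n" and i
    by (simp_all add: right_diff_distrib)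
  ultimately have "flat_alg (\<lambda>x. flat 0 (c * (x $ i - a $ i)) * flat 0 (c * (b $ i - x $ i)))" for i
    by simp
  then show ?thesis
    unfolding box_bump_def[abs_def] by (intro smooth_flat_alg flat_alg_prod)
qed

lemma box_bump_bounds: "0 \<le> box_bump a b c x" "box_bump a b c x \<le> 1"
  unfolding box_bump_def
  by (auto intro!: prod_nonneg prod_le_1 mult_nonneg_nonneg mult_le_one flat_0_bounds)

lemma box_bump_support: "c > 0 \<Longrightarrow> {x. box_bump a b c x \<noteq> 0} = box a b"
  by (auto simp: box_bump_def flat_def mem_box_cart zero_less_mult_iff)

lemma test_fun_box_bump:
  assumes "cbox a b \<subseteq> \<Omega>" "c > 0"
  shows "test_fun \<Omega> (box_bump a b c)"
proof -
  have "closure (box a b) \<subseteq> cbox a b"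
    by (intro closure_minimal box_subset_cbox closed_cbox)
  then show ?thesis
    using assms unfolding test_fun_def box_bump_support[OF assms(2)]
    by (auto intro: smooth_box_bump bounded_subset[OF bounded_cbox] simp: compact_eq_bounded_closed)
qed

lemma box_bump_tendsto: "(\<lambda>k. box_bump a b (real (Suc k)) x) \<longlonglongrightarrow> indicator (box a b) x"
proof -
  have "indicator (box a b) x =
    (\<Prod>i\<in>UNIV. (if x $ i - a $ i > 0 then 1 else 0) * (if b $ i - x $ i > 0 then 1 else 0) :: real)"
    by (auto simp: indicator_def mem_box_cart)
  then show ?thesis
    unfolding box_bump_def by (simp only:) (intro tendsto_prod tendsto_mult flat_0_scale_tendsto)
qed

text \<open>Open boxes are stable under intersection and generate the Borel sets, so a Dynkin
  argument extends the vanishing integrals to all Borel sets; the integral over the whole space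
  serves the complement step. A Borel representative \<open>h\<close> of \<open>g\<close> is used
  because the argument takes place over \<open>lborel\<close>.\<close>

lemma AE_lebesgue_zero_if_box_integrals_zero:
  fixes g :: "'a::euclidean_space \<Rightarrow> real"
  assumes g: "integrable lebesgue g"
    and box: "\<And>a b. (\<integral>x. indicator (box a b) x * g x \<partial>lebesgue) = 0"
    and UNIV: "(\<integral>x. g x \<partial>lebesgue) = 0"
  shows "AE x in lebesgue. g x = 0"
proof -
  obtain h where [measurable]: "h \<in> borel_measurable borel" and h: "AE x in lborel. g x = h x"
    using completion_ex_borel_measurable_real[of g lborel] borel_measurable_integrable[OF g] by auto
  have gh: "AE x in lebesgue. g x = h x"
    by (rule AE_completion[OF h])
  have gm: "g \<in> borel_measurable lebesgue" and hm: "h \<in> borel_measurable lebesgue"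
    using g by (auto intro: measurable_completion)
  have "integrable lebesgue h"
    using g by (rule integrable_cong_AE_imp) (use gh in \<open>auto intro: measurable_completion\<close>)
  then have hi: "integrable lborel h"
    by (simp add: integrable_completion)
  have eq: "(\<integral>x. indicator A x * g x \<partial>lebesgue) = set_lebesgue_integral lborel A h"
    if [measurable]: "A \<in> sets borel" for A
  proof -
    have Am: "A \<in> sets lebesgue" using that by auto
    have "(\<integral>x. indicator A x * g x \<partial>lebesgue) = (\<integral>x. indicator A x * h x \<partial>lebesgue)"
      by (rule integral_cong_AE)
        (use gh gm hm Am in \<open>auto intro!: borel_measurable_times borel_measurable_indicator\<close>)
    also have "\<dots> = (\<integral>x. indicator A x * h x \<partial>lborel)"
      by (rule integral_completion) measurable
    finally show ?thesis by (simp add: set_lebesgue_integral_def)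
  qed
  have si: "set_integrable lborel A h" if "A \<in> sets borel" for A
    using that hi unfolding set_integrable_def by (intro integrable_mult_indicator) auto
  have U: "set_lebesgue_integral lborel UNIV h = 0"
    using eq[of UNIV] UNIV by simp
  have "set_lebesgue_integral lborel A h = 0" if "A \<in> sets borel" for A
  proof -
    let ?E = "range (\<lambda>(a, b). box a b::'a set)"
    have sb: "sigma_sets UNIV ?E = sets borel"
      by (simp add: borel_eq_box)
    have "Int_stable ?E"
      by (auto simp: Int_stable_def box_Int_box)
    moreover have "?E \<subseteq> Pow UNIV" by simp
    moreover have "A \<in> sigma_sets UNIV ?E" using that sb by simp
    ultimately show ?thesis
    proof (induction rule: sigma_sets_induct_disjoint)
      case (basic A)
      then show ?case using eq box by (auto)
    next
      case empty
      then show ?case by (simp add: set_lebesgue_integral_def)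
    next
      case (compl A)
      then have A: "A \<in> sets borel" using sb by simp
      have "set_lebesgue_integral lborel (A \<union> (UNIV - A)) h
          = set_lebesgue_integral lborel A h + set_lebesgue_integral lborel (UNIV - A) h"
        using A by (intro set_integral_Un si) auto
      then show ?case using U compl by simp
    next
      case (union A)
      then have "\<And>i. A i \<in> sets borel" using sb by auto
      then have "set_lebesgue_integral lborel (\<Union>i. A i) h = (\<Sum>i. set_lebesgue_integral lborel (A i) h)"
        using union(1) by (intro lebesgue_integral_countable_add si)
          (auto simp: disjoint_family_on_def)
      then show ?case using union by simp
    qed
  qed
  then have "AE x in lborel. h x = 0"
    by (intro sigma_finite_measure.density_zero[OF sigma_finite_lborel hi]) auto
  with h have "AE x in lborel. g x = 0" by auto
  then show ?thesis by (rule AE_completion)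
qed

text \<open>Dominated convergence along the bumps gives zero integral over every open box whose
  closed box lies in \<open>\<Omega>\<close>. After localisation to one such box the criterion on
  box integrals applies, and countably many closed boxes exhaust \<open>\<Omega>\<close>.\<close>

lemma fundamental_lemma:
  fixes g :: "real^'n::finite \<Rightarrow> real"
  assumes op: "open \<Omega>" and g: "integrable (lebesgue_on \<Omega>) g"
    and test: "\<And>\<xi>. test_fun \<Omega> \<xi> \<Longrightarrow> (\<integral>x. g x * \<xi> x \<partial>lebesgue_on \<Omega>) = 0"
  shows "AE x in lebesgue_on \<Omega>. g x = 0"
proof -
  have Om: "\<Omega> \<in> sets lebesgue" using op by auto
  have gi: "integrable lebesgue (\<lambda>x. indicator \<Omega> x * g x)"
    using g Om by (simp add: integrable_restrict_space)
  have box0: "(\<integral>x. indicator (box a b) x * (indicator \<Omega> x * g x) \<partial>lebesgue) = 0" if "cbox a b \<subseteq> \<Omega>" for a b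
  proof -
    have "(\<lambda>k. \<integral>x. (indicator \<Omega> x * g x) * box_bump a b (real (Suc k)) x \<partial>lebesgue) \<longlonglongrightarrow>
       (\<integral>x. (indicator \<Omega> x * g x) * indicator (box a b) x \<partial>lebesgue)"
    proof (rule integral_dominated_convergence)
      show "integrable lebesgue (\<lambda>x. \<bar>indicator \<Omega> x * g x\<bar>)" using gi by (rule integrable_abs)
      have "continuous_on UNIV (box_bump a b (real (Suc k)))" for k
        using smooth_box_bump[of a b "real (Suc k)"]
        by (auto elim: smooth.cases intro!: continuous_at_imp_continuous_on differentiable_imp_continuous_within)
      then have "box_bump a b (real (Suc k)) \<in> borel_measurable lebesgue" for k
        by (intro measurable_completion) (auto intro: borel_measurable_continuous_onI)
      then show "(\<lambda>x. (indicator \<Omega> x * g x) * box_bump a b (real (Suc k)) x) \<in> borel_measurable lebesgue" for k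
        by (intro borel_measurable_times borel_measurable_integrable[OF gi])
      show "(\<lambda>x. (indicator \<Omega> x * g x) * indicator (box a b) x) \<in> borel_measurable lebesgue"
        by (intro borel_measurable_times borel_measurable_integrable[OF gi]) (auto intro: borel_measurable_indicator)
      show "AE x in lebesgue. (\<lambda>k. (indicator \<Omega> x * g x) * box_bump a b (real (Suc k)) x) \<longlonglongrightarrow> (indicator \<Omega> x * g x) * indicator (box a b) x"
        by (intro AE_I2 tendsto_mult tendsto_const box_bump_tendsto)
      show "AE x in lebesgue. norm ((indicator \<Omega> x * g x) * box_bump a b (real (Suc k)) x) \<le> \<bar>indicator \<Omega> x * g x\<bar>" for k
        by (intro AE_I2) (auto simp: abs_mult box_bump_bounds intro!: mult_left_le)
    qed
    moreover have "(\<integral>x. (indicator \<Omega> x * g x) * box_bump a b (real (Suc k)) x \<partial>lebesgue) = 0" for k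
      using test[OF test_fun_box_bump[OF that, of "real (Suc k)"]] Om
      by (simp add: integral_restrict_space mult.assoc)
    ultimately show ?thesis
      by (simp add: LIMSEQ_const_iff mult.commute)
  qed
  \<comment> \<open>Cutting \<open>g\<close> off to \<open>box c d\<close> makes the criterion
    applicable: every test box then meets \<open>box c d\<close> in a box that stays inside
    \<open>\<Omega>\<close>, and the integral over the whole space is the one over
    \<open>box c d\<close> itself.\<close>
  have AEbox: "AE x in lebesgue. x \<in> cbox c d \<longrightarrow> g x = 0" if cd: "cbox c d \<subseteq> \<Omega>" for c d
  proof -
    let ?g = "\<lambda>x. indicator (box c d) x * (indicator \<Omega> x * g x)"
    have "AE x in lebesgue. ?g x = 0"
    proof (rule AE_lebesgue_zero_if_box_integrals_zero)
      show "integrable lebesgue ?g"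
        using integrable_mult_indicator[OF _ gi, of "box c d"] by simp
      show "integral\<^sup>L lebesgue ?g = 0" by (rule box0[OF cd])
      show "(\<integral>x. indicator (box a b) x * ?g x \<partial>lebesgue) = 0" for a b
      proof -
        obtain a' b' where ab: "box a b \<inter> box c d = box a' b'" "cbox a b \<inter> cbox c d = cbox a' b'"
          using box_Int_box[of a b c d] Int_interval[of a b c d] by blast
        have *: "indicator (box a b) x * ?g x = indicator (box a' b') x * (indicator \<Omega> x * g x)" for x
          unfolding ab(1)[symmetric] by (auto simp: indicator_def)
        show ?thesis unfolding *
          using ab(2) cd by (intro box0) blast
      qed
    qed
    \<comment> \<open>The cut-off says nothing on the boundary of the box, which is
      negligible.\<close>
    moreover have "AE x in lebesgue. x \<notin> cbox c d - box c d"
      using negligible_frontier_interval[of c d] by (intro AE_not_in) (simp add: negligible_iff_null_sets)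
    ultimately show ?thesis
      by eventually_elim (use cd in \<open>auto simp: indicator_def split: if_splits\<close>)
  qed
  obtain \<D> where D: "countable \<D>" "\<D> \<subseteq> Pow \<Omega>" "\<And>X. X \<in> \<D> \<Longrightarrow> \<exists>a b. X = cbox a b" "\<Union>\<D> = \<Omega>"
    using open_countable_Union_open_cbox[OF op] by metis
  have "AE x in lebesgue. \<forall>X\<in>\<D>. x \<in> X \<longrightarrow> g x = 0"
    proof (subst AE_ball_countable[OF D(1)], intro ballI)
    fix X assume "X \<in> \<D>"
    then show "AE x in lebesgue. x \<in> X \<longrightarrow> g x = 0"
      using D(2) D(3)[of X] AEbox by blast
  qed
  then have "AE x in lebesgue. x \<in> \<Omega> \<longrightarrow> g x = 0"
    by eventually_elim (use D(4) in auto)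
  then show ?thesis using Om by (simp add: AE_restrict_space_iff)
qed

subsection \<open>Weak gradients\<close>

lemma smooth_differentiable: "smooth f \<Longrightarrow> f differentiable (at x)"
  by (auto elim: smooth.cases)

lemma smooth_pderiv: "smooth f \<Longrightarrow> smooth (pderiv i f)"
  by (auto elim: smooth.cases)

lemma smooth_continuous_on: "smooth f \<Longrightarrow> continuous_on S f"
  by (intro continuous_at_imp_continuous_on ballI differentiable_imp_continuous_within
      smooth_differentiable)

lemma smooth_has_derivative_line:
  assumes "smooth f"
  shows "((\<lambda>t. f (x + t *\<^sub>R axis i 1)) has_real_derivative pderiv i f x) (at 0)"
proof -
  have "(f has_derivative frechet_derivative f (at x)) (at (x + 0 *\<^sub>R axis i 1))"
    using smooth_differentiable[OF assms, of x] by (simp add: frechet_derivative_works)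
  moreover have "((\<lambda>t. x + t *\<^sub>R axis i 1) has_derivative (\<lambda>t. t *\<^sub>R axis i 1)) (at (0::real))"
    by (auto intro!: derivative_eq_intros)
  ultimately have "((\<lambda>t. f (x + t *\<^sub>R axis i 1)) has_derivative
      (\<lambda>t. frechet_derivative f (at x) (t *\<^sub>R axis i 1))) (at 0)"
    by (rule has_derivative_compose[rotated])
  moreover have "linear (frechet_derivative f (at x))"
    by (intro linear_frechet_derivative smooth_differentiable assms)
  ultimately show ?thesis
    by (simp add: has_field_derivative_def pderiv_def linear_scale mult_commute_abs)
qed

lemma test_fun_smooth: "test_fun \<Omega> \<xi> \<Longrightarrow> smooth \<xi>"
  by (simp add: test_fun_def)

lemma test_fun_bounded:
  assumes "test_fun \<Omega> \<xi>"
  shows "\<exists>M. \<forall>x. \<bar>\<xi> x\<bar> \<le> M"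
proof -
  have "compact (\<xi> ` closure {x. \<xi> x \<noteq> 0})"
    using assms by (intro compact_continuous_image smooth_continuous_on)
      (auto simp: test_fun_def)
  then obtain M where M: "\<And>y. y \<in> \<xi> ` closure {x. \<xi> x \<noteq> 0} \<Longrightarrow> norm y \<le> M"
    by (meson compact_imp_bounded bounded_iff)
  have "\<bar>\<xi> x\<bar> \<le> max M 0" for x
    using M[of "\<xi> x"] closure_subset[of "{x. \<xi> x \<noteq> 0}"] by (cases "\<xi> x = 0") auto
  then show ?thesis by blast
qed

lemma pderiv_eq_0_outside_support:
  assumes "x \<notin> closure {x. f x \<noteq> 0}"
  shows "pderiv i f x = 0"
proof -
  have "(f has_derivative (\<lambda>_. 0)) (at x)"
    by (rule has_derivative_transform_within_open[of "\<lambda>_. 0" _ _ _ "- closure {x. f x \<noteq> 0}"])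
      (use assms closure_subset[of "{x. f x \<noteq> 0}"] in auto)
  then show ?thesis by (rule pderiv_eqI)
qed

lemma test_fun_pderiv:
  assumes "test_fun \<Omega> \<xi>"
  shows "test_fun \<Omega> (pderiv i \<xi>)"
proof -
  have "closure {x. pderiv i \<xi> x \<noteq> 0} \<subseteq> closure {x. \<xi> x \<noteq> 0}"
    using pderiv_eq_0_outside_support by (intro closure_minimal) auto
  moreover have "compact (closure {x. pderiv i \<xi> x \<noteq> 0})"
    using assms calculation unfolding test_fun_def
    by (meson bounded_subset closed_closure compact_eq_bounded_closed)
  ultimately show ?thesis
    using assms smooth_pderiv[of \<xi> i] unfolding test_fun_def by blast
qed

text \<open>By translation invariance the difference quotients of \<open>F\<close> have integral zero; dominated
  convergence replaces the usual appeal to Fubini.\<close>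

lemma integral_directional_derivative_zero:
  fixes F F' :: "'a::euclidean_space \<Rightarrow> real"
  assumes D: "\<And>x. ((\<lambda>t. F (x + t *\<^sub>R e)) has_real_derivative F' x) (at 0)"
    and cF: "continuous_on UNIV F" and cF': "continuous_on UNIV F'"
    and K: "compact K" "\<And>x. x \<notin> K \<Longrightarrow> F x = 0" "\<And>x. x \<notin> K \<Longrightarrow> F' x = 0"
  shows "(\<integral>x. F' x \<partial>lborel) = 0"
proof -
  have Dt: "((\<lambda>t. F (x + t *\<^sub>R e)) has_real_derivative F' (x + s *\<^sub>R e)) (at s)" for x s
    using DERIV_shift[of "\<lambda>t. F (x + t *\<^sub>R e)" "F' (x + s *\<^sub>R e)" 0 s] D[of "x + s *\<^sub>R e"]
    by (simp add: algebra_simps scaleR_add_left)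
  have "compact (F' ` K)"
    using K(1) cF' by (intro compact_continuous_image) (auto intro: continuous_on_subset)
  then obtain M where M: "\<And>y. y \<in> F' ` K \<Longrightarrow> norm y \<le> M"
    by (meson compact_imp_bounded bounded_iff)
  define M' where "M' = max M 0"
  have M': "\<bar>F' x\<bar> \<le> M'" "0 \<le> M'" for x
    using M[of "F' x"] K(3)[of x] by (cases "x \<in> K"; auto simp: M'_def)+
  obtain R where R: "\<And>x. x \<in> K \<Longrightarrow> norm x \<le> R"
    using K(1) by (meson compact_imp_bounded bounded_iff)
  define h where "h n = 1 / real (Suc n)" for n
  have h: "h n > 0" "h n \<le> 1" for n
    by (auto simp: h_def)
  have h0: "h \<longlonglongrightarrow> 0"
    using LIMSEQ_inverse_real_of_nat unfolding h_def by (simp add: inverse_eq_divide)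
  define q where "q n x = (F (h n *\<^sub>R e + x) - F x) / h n" for n x
  have [measurable]: "F \<in> borel_measurable borel" "F' \<in> borel_measurable borel"
    using cF cF' by (auto intro: borel_measurable_continuous_onI)
  \<comment> \<open>The mean value theorem bounds the quotient by the supremum of \<open>F'\<close>.
    Shifts have length at most \<open>norm e\<close>, so all quotients vanish outside one ball; this
    gives a dominating function independent of \<open>n\<close>.\<close>
  have qbound: "\<bar>q n x\<bar> \<le> M' * indicator (cball 0 (R + norm e)) x" for n x
  proof (cases "norm x \<le> R + norm e")
    case True
    have "\<exists>z. 0 < z \<and> z < h n \<and> F (x + h n *\<^sub>R e) - F (x + 0 *\<^sub>R e) = (h n - 0) * F' (x + z *\<^sub>R e)"
      by (rule MVT2[OF h(1)]) (rule Dt)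
    then obtain z where z: "F (x + h n *\<^sub>R e) - F x = h n * F' (x + z *\<^sub>R e)" by auto
    have "q n x = F' (x + z *\<^sub>R e)"
      using z h(1)[of n] by (simp add: q_def add.commute)
    then show ?thesis using True M' by simp
  next
    case False
    have "norm x \<le> norm (h n *\<^sub>R e + x) + norm (h n *\<^sub>R e)"
      using norm_triangle_ineq4[of "h n *\<^sub>R e + x" "h n *\<^sub>R e"] by simp
    moreover have "norm (h n *\<^sub>R e) \<le> norm e"
      using h[of n] by (simp add: mult_left_le_one_le)
    ultimately have "x \<notin> K" "h n *\<^sub>R e + x \<notin> K"
      using R[of x] R[of "h n *\<^sub>R e + x"] False norm_ge_zero[of e] by linarith+
    then show ?thesis using K(2) M' by (simp add: q_def)
  qed
  have iF: "integrable lborel F"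
  proof -
    have "(\<lambda>x. indicator K x *\<^sub>R F x) = F" using K(2) by (auto simp: indicator_def fun_eq_iff)
    then show ?thesis
      using borel_integrable_compact[OF K(1), of F] cF continuous_on_subset by fastforce
  qed
  have trans: "integrable lborel (\<lambda>x. F (c + x)) \<and> (\<integral>x. F (c + x) \<partial>lborel) = (\<integral>x. F x \<partial>lborel)" for c
  proof -
    have "integrable (distr lborel borel ((+) c)) F"
      using iF by (simp add: lborel_distr_plus)
    then have "integrable lborel (\<lambda>x. F (c + x))"
      by (subst (asm) integrable_distr_eq) auto
    moreover have "(\<integral>x. F x \<partial>distr lborel borel ((+) c)) = (\<integral>x. F (c + x) \<partial>lborel)"
      by (rule integral_distr) auto
    ultimately show ?thesis by (simp add: lborel_distr_plus)
  qed
  have q0: "(\<integral>x. q n x \<partial>lborel) = 0" for n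
    unfolding q_def using trans[of "h n *\<^sub>R e"] iF by simp
  have "(\<lambda>n. \<integral>x. q n x \<partial>lborel) \<longlonglongrightarrow> (\<integral>x. F' x \<partial>lborel)"
  proof (rule integral_dominated_convergence)
    show "integrable lborel (\<lambda>x. M' * indicator (cball 0 (R + norm e)) x)"
      by (intro integrable_mult_right integrable_real_indicator)
        (use emeasure_bounded_finite[OF bounded_cball] in \<open>auto simp: top.not_eq_extremum\<close>)
    show "AE x in lborel. (\<lambda>n. q n x) \<longlonglongrightarrow> F' x"
    proof (rule AE_I2)
      fix x
      have "((\<lambda>t. (F (x + t *\<^sub>R e) - F x) / t) \<longlongrightarrow> F' x) (at 0)"
        using D[of x] by (simp add: has_field_derivative_iff)
      moreover have "filterlim h (at 0) sequentially"
        using h0 h(1) by (auto simp: filterlim_at intro!: always_eventually) (metis less_irrefl)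
      ultimately have "((\<lambda>n. (F (x + h n *\<^sub>R e) - F x) / h n) \<longlonglongrightarrow> F' x)"
        by (rule filterlim_compose)
      then show "(\<lambda>n. q n x) \<longlonglongrightarrow> F' x"
        by (simp add: q_def add.commute)
    qed
    show "AE x in lborel. norm (q n x) \<le> M' * indicator (cball 0 (R + norm e)) x" for n
      using qbound by simp
    show "q n \<in> borel_measurable lborel" for n
      unfolding q_def[abs_def] by measurable
  qed auto
  then show ?thesis using q0 by (simp add: LIMSEQ_const_iff)
qed

text \<open>The derivative of \<open>w * \<xi>\<close> integrates to zero. The compact support of
  \<open>\<xi>\<close> inside \<open>\<Omega>\<close> allows every integral to be moved between
  \<open>lebesgue_on \<Omega>\<close> and \<open>lborel\<close>, so \<open>w\<close> needs no decay
  and the boundary of \<open>\<Omega>\<close> needs no regularity.\<close>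

lemma integration_by_parts_test_fun:
  assumes op: "open \<Omega>" and w: "smooth w" and t: "test_fun \<Omega> \<xi>"
  shows "(\<integral>x. w x * pderiv i \<xi> x \<partial>(lebesgue_on \<Omega>)) = - (\<integral>x. pderiv i w x * \<xi> x \<partial>(lebesgue_on \<Omega>))"
proof -
  let ?K = "closure {x. \<xi> x \<noteq> 0}"
  have Om: "\<Omega> \<in> sets lebesgue" using op by auto
  have K: "compact ?K" "?K \<subseteq> \<Omega>" using t by (auto simp: test_fun_def)
  have xi: "smooth \<xi>" using t by (rule test_fun_smooth)
  have out: "\<xi> x = 0" "pderiv i \<xi> x = 0" if "x \<notin> ?K" for x
    using that closure_subset[of "{x. \<xi> x \<noteq> 0}"] pderiv_eq_0_outside_support[of x \<xi> i] by auto
  have red: "integrable lborel f \<and> (\<integral>x. f x \<partial>lebesgue_on \<Omega>) = (\<integral>x. f x \<partial>lborel)"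
    if c: "continuous_on UNIV f" and z: "\<And>x. x \<notin> ?K \<Longrightarrow> f x = 0" for f :: "real^'a \<Rightarrow> real"
  proof -
    have "(\<lambda>x. indicator ?K x *\<^sub>R f x) = f" using z by (auto simp: indicator_def fun_eq_iff)
    then have "integrable lborel f"
      using borel_integrable_compact[OF K(1), of f] c continuous_on_subset by fastforce
    moreover have "(\<lambda>x. indicator \<Omega> x *\<^sub>R f x) = f"
      using z K(2) by (auto simp: indicator_def fun_eq_iff)
    then have "(\<integral>x. f x \<partial>lebesgue_on \<Omega>) = (\<integral>x. f x \<partial>lebesgue)"
      using Om by (simp add: integral_restrict_space)
    moreover have "f \<in> borel_measurable lborel"
      using c by (auto intro: borel_measurable_continuous_onI)
    then have "(\<integral>x. f x \<partial>lebesgue) = (\<integral>x. f x \<partial>lborel)"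
      by (rule integral_completion)
    ultimately show ?thesis by simp
  qed
  have cont: "continuous_on UNIV (\<lambda>x. w x * pderiv i \<xi> x)"
    "continuous_on UNIV (\<lambda>x. pderiv i w x * \<xi> x)"
    by (intro continuous_intros smooth_continuous_on smooth_pderiv w xi)+
  have r1: "integrable lborel (\<lambda>x. w x * pderiv i \<xi> x) \<and>
      (\<integral>x. w x * pderiv i \<xi> x \<partial>lebesgue_on \<Omega>) = (\<integral>x. w x * pderiv i \<xi> x \<partial>lborel)"
    by (rule red[OF cont(1)]) (metis out(2) mult_zero_right)
  have r2: "integrable lborel (\<lambda>x. pderiv i w x * \<xi> x) \<and>
      (\<integral>x. pderiv i w x * \<xi> x \<partial>lebesgue_on \<Omega>) = (\<integral>x. pderiv i w x * \<xi> x \<partial>lborel)"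
    by (rule red[OF cont(2)]) (metis out(1) mult_zero_right)
  have "(\<integral>x. w x * pderiv i \<xi> x + pderiv i w x * \<xi> x \<partial>lborel) = 0"
  proof (rule integral_directional_derivative_zero[where F = "\<lambda>x. w x * \<xi> x" and e = "axis i 1" and K = ?K])
    show "((\<lambda>t. w (x + t *\<^sub>R axis i 1) * \<xi> (x + t *\<^sub>R axis i 1)) has_real_derivative
        w x * pderiv i \<xi> x + pderiv i w x * \<xi> x) (at 0)" for x
      using DERIV_mult'[OF smooth_has_derivative_line[OF w, of x i] smooth_has_derivative_line[OF xi, of x i]]
      by simp
    show "continuous_on UNIV (\<lambda>x. w x * \<xi> x)"
      by (intro continuous_intros smooth_continuous_on w xi)
    show "continuous_on UNIV (\<lambda>x. w x * pderiv i \<xi> x + pderiv i w x * \<xi> x)"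
      by (intro continuous_intros cont)
    show "compact ?K" by (rule K)
    show "w x * \<xi> x = 0" "w x * pderiv i \<xi> x + pderiv i w x * \<xi> x = 0" if "x \<notin> ?K" for x
      unfolding out[OF that] by simp_all
  qed
  then have "(\<integral>x. w x * pderiv i \<xi> x \<partial>lborel) + (\<integral>x. pderiv i w x * \<xi> x \<partial>lborel) = 0"
    using r1 r2 by simp
  then show ?thesis
    using r1 r2 by simp
qed

lemma L1_continuous:
  assumes op: "open \<Omega>" and bd: "bounded \<Omega>" and c: "continuous_on UNIV f"
  shows "L1 \<Omega> f"
proof -
  have Om: "\<Omega> \<in> sets lebesgue" using op by auto
  have "integrable lborel (\<lambda>x. indicator (closure \<Omega>) x *\<^sub>R f x)"
    using bd c by (intro borel_integrable_compact) (auto intro: continuous_on_subset)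
  then have "integrable lborel (\<lambda>x. indicator \<Omega> x *\<^sub>R (indicator (closure \<Omega>) x *\<^sub>R f x))"
    by (rule integrable_mult_indicator[rotated]) (use op in auto)
  also have "(\<lambda>x. indicator \<Omega> x *\<^sub>R (indicator (closure \<Omega>) x *\<^sub>R f x)) = (\<lambda>x. indicator \<Omega> x *\<^sub>R f x)"
    using closure_subset[of \<Omega>] by (auto simp: indicator_def fun_eq_iff)
  finally have "integrable lebesgue (\<lambda>x. indicator \<Omega> x *\<^sub>R f x)"
    by (subst integrable_completion) (auto dest: borel_measurable_integrable)
  then have "integrable (lebesgue_on \<Omega>) f"
    using Om by (simp add: integrable_restrict_space)
  then show ?thesis by (auto simp: L1_def)
qed

lemma L1_add: "L1 \<Omega> u \<Longrightarrow> L1 \<Omega> v \<Longrightarrow> L1 \<Omega> (\<lambda>x. u x + v x)"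
  by (auto simp: L1_def)

lemma L1_diff: "L1 \<Omega> u \<Longrightarrow> L1 \<Omega> v \<Longrightarrow> L1 \<Omega> (\<lambda>x. u x - v x)"
  by (auto simp: L1_def)

lemma L1_cong: "(\<And>x. x \<in> \<Omega> \<Longrightarrow> u x = v x) \<Longrightarrow> L1 \<Omega> u \<longleftrightarrow> L1 \<Omega> v"
  unfolding L1_def by (intro arg_cong2[of _ _ _ _ "(\<and>)"] measurable_cong Bochner_Integration.integrable_cong) auto

text \<open>Agreement with a smooth function is asked for on \<open>\<Omega>\<close> only, so that
  the result covers test functions as well as the functions described by
  \<open>smooth_closure\<close>.\<close>

lemma weak_grad_smooth:
  assumes op: "open \<Omega>" and bd: "bounded \<Omega>" and w: "smooth w" and vw: "\<And>x. x \<in> \<Omega> \<Longrightarrow> v x = w x"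
  shows "weak_grad \<Omega> v (\<lambda>x. \<chi> i. pderiv i w x)"
  unfolding weak_grad_def
proof (intro conjI allI impI)
  have "L1 \<Omega> w"
    by (intro L1_continuous op bd smooth_continuous_on w)
  then show "L1 \<Omega> v" by (subst L1_cong[of \<Omega> v w, OF vw])
  show "L1 \<Omega> (\<lambda>x. (\<chi> i. pderiv i w x) $ i)" for i
    using L1_continuous[OF op bd smooth_continuous_on[OF smooth_pderiv[OF w]]] by simp
next
  fix \<xi> i assume t: "test_fun \<Omega> \<xi>"
  have "(\<integral>x. v x * pderiv i \<xi> x \<partial>(lebesgue_on \<Omega>)) = (\<integral>x. w x * pderiv i \<xi> x \<partial>(lebesgue_on \<Omega>))"
    by (rule Bochner_Integration.integral_cong) (auto simp: vw)
  then show "(\<integral>x. v x * pderiv i \<xi> x \<partial>(lebesgue_on \<Omega>)) =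
      - (\<integral>x. (\<chi> i. pderiv i w x) $ i * \<xi> x \<partial>(lebesgue_on \<Omega>))"
    using integration_by_parts_test_fun[OF op w t, of i] by simp
qed

lemma L1_mult_test_fun:
  assumes "open \<Omega>" "L1 \<Omega> u" "test_fun \<Omega> \<xi>"
  shows "integrable (lebesgue_on \<Omega>) (\<lambda>x. u x * \<xi> x)"
proof -
  obtain M where M: "\<And>x. \<bar>\<xi> x\<bar> \<le> M" using test_fun_bounded[OF assms(3)] by auto
  have "\<xi> \<in> borel_measurable borel"
    using assms(3) by (intro borel_measurable_continuous_onI smooth_continuous_on test_fun_smooth)
  then have "\<xi> \<in> borel_measurable lebesgue"
    by (intro measurable_completion) auto
  then have "\<xi> \<in> borel_measurable (lebesgue_on \<Omega>)"
    by (rule measurable_restrict_space1)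
  moreover have Mu: "integrable (lebesgue_on \<Omega>) (\<lambda>x. M * \<bar>u x\<bar>)"
    and "u \<in> borel_measurable (lebesgue_on \<Omega>)"
    using assms(2) by (auto simp: L1_def)
  moreover have "norm (u x * \<xi> x) \<le> norm (M * \<bar>u x\<bar>)" for x
  proof -
    have "\<bar>\<xi> x\<bar> \<le> \<bar>M\<bar>" using M[of x] by linarith
    then show ?thesis by (simp add: abs_mult mult.commute mult_right_mono)
  qed
  ultimately show ?thesis
    by (intro Bochner_Integration.integrable_bound[OF Mu] AE_I2 borel_measurable_times)
qed

lemma weak_grad_combine:
  assumes op: "open \<Omega>" and u: "weak_grad \<Omega> u g" and v: "weak_grad \<Omega> v h"
  shows weak_grad_add: "weak_grad \<Omega> (\<lambda>x. u x + v x) (\<lambda>x. g x + h x)"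
    and weak_grad_diff: "weak_grad \<Omega> (\<lambda>x. u x - v x) (\<lambda>x. g x - h x)"
proof -
  have i: "integrable (lebesgue_on \<Omega>) (\<lambda>x. u x * pderiv i \<xi> x)"
    "integrable (lebesgue_on \<Omega>) (\<lambda>x. v x * pderiv i \<xi> x)"
    "integrable (lebesgue_on \<Omega>) (\<lambda>x. g x $ i * \<xi> x)"
    "integrable (lebesgue_on \<Omega>) (\<lambda>x. h x $ i * \<xi> x)" if "test_fun \<Omega> \<xi>" for \<xi> i
    using that u v by (auto intro!: L1_mult_test_fun op test_fun_pderiv simp: weak_grad_def)
  show "weak_grad \<Omega> (\<lambda>x. u x + v x) (\<lambda>x. g x + h x)"
    using u v i unfolding weak_grad_def
    by (auto intro: L1_add simp: algebra_simps)
  show "weak_grad \<Omega> (\<lambda>x. u x - v x) (\<lambda>x. g x - h x)"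
    using u v i unfolding weak_grad_def
    by (auto intro: L1_diff simp: algebra_simps)
qed

text \<open>The difference of two weak gradients is a weak gradient of the zero function, so each
  component integrates to zero against every test function.\<close>

lemma weak_grad_unique:
  assumes op: "open \<Omega>" and g: "weak_grad \<Omega> u g" and h: "weak_grad \<Omega> u h"
  shows "AE x in lebesgue_on \<Omega>. g x = h x"
proof -
  have d: "weak_grad \<Omega> (\<lambda>x. 0) (\<lambda>x. g x - h x)"
    using weak_grad_diff[OF op g h] by simp
  have "AE x in lebesgue_on \<Omega>. (g x - h x) $ i = 0" for i
    by (rule fundamental_lemma[OF op]) (use d in \<open>auto simp: weak_grad_def L1_def\<close>)
  then have "AE x in lebesgue_on \<Omega>. \<forall>i. (g x - h x) $ i = 0"
    by (subst AE_all_countable) auto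
  then show ?thesis by eventually_elim (auto simp: vec_eq_iff)
qed

lemma weak_grad_wgrad: "W11 \<Omega> u \<Longrightarrow> weak_grad \<Omega> u (wgrad \<Omega> u)"
  unfolding W11_def wgrad_def by (metis someI)

lemma AE_wgrad_eq:
  assumes "open \<Omega>" "weak_grad \<Omega> u g"
  shows "AE x in lebesgue_on \<Omega>. wgrad \<Omega> u x = g x"
  using assms weak_grad_unique weak_grad_wgrad W11_def by metis

lemma W11_imp_L1: "W11 \<Omega> u \<Longrightarrow> L1 \<Omega> u"
  by (auto simp: W11_def weak_grad_def)

lemma wgrad_measurable:
  assumes "W11 \<Omega> u"
  shows "wgrad \<Omega> u \<in> borel_measurable (lebesgue_on \<Omega>)"
proof -
  have "(\<lambda>x. wgrad \<Omega> u x $ i) \<in> borel_measurable (lebesgue_on \<Omega>)" for i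
    using weak_grad_wgrad[OF assms] by (auto simp: weak_grad_def L1_def)
  then show ?thesis
    by (intro borel_measurable_euclidean_space[THEN iffD2]) (auto simp: Basis_vec_def inner_axis)
qed

subsection \<open>Doubling integrands\<close>

lemma ennpow_ennreal: "0 \<le> a \<Longrightarrow> ennpow (ennreal a) p = ennreal (a powr p)"
  by (simp add: ennpow_def)

lemma ennpow_top: "ennpow top p = top"
  by (simp add: ennpow_def)

lemma ennpow_0: "ennpow 0 p = 0"
  by (simp add: ennpow_def)

lemma ennpow_1: "ennpow a 1 = a"
  by (cases a) (simp_all add: ennpow_ennreal ennpow_top)

lemma ennpow_mono: "a \<le> b \<Longrightarrow> 0 \<le> p \<Longrightarrow> ennpow a p \<le> ennpow b p"
  by (cases a; cases b) (simp_all add: ennpow_ennreal ennpow_top powr_mono2 top_unique)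

lemma ennpow_cmult: "0 < c \<Longrightarrow> ennpow (ennreal c * a) p = ennreal (c powr p) * ennpow a p"
  by (cases a)
    (simp_all add: ennreal_mult[symmetric] ennpow_ennreal ennpow_top powr_mult ennreal_mult_top)

lemma ennpow_measurable [measurable]: "(\<lambda>a. ennpow a p) \<in> borel_measurable borel"
  unfolding ennpow_def by measurable

text \<open>Young's inequality for \<open>t = (t^p)^(1/p) * 1^(1 - 1/p)\<close> gives
  \<open>t \<le> t^p / p + (1 - 1/p)\<close>. Both terms are then enlarged using
  \<open>p \<ge> 1\<close>.\<close>

lemma le_ennpow_plus:
  assumes "1 \<le> p"
  shows "a \<le> ennpow a p + ennreal (p - 1)"
proof (cases a)
  case (real t)
  have "t \<le> t powr p + (p - 1)"
  proof (cases "t = 0")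
    case False
    then have "t > 0" using real by simp
    have "t = (t powr p) powr (1 / p) * 1 powr (1 - 1 / p)"
      using assms \<open>t > 0\<close> by (simp add: powr_powr)
    also have "\<dots> \<le> 1 / p * t powr p + (1 - 1 / p) * 1"
      using assms \<open>t > 0\<close> by (intro Youngs_inequality_0) auto
    also have "\<dots> \<le> t powr p + (p - 1)"
    proof (rule add_mono)
      show "1 / p * t powr p \<le> t powr p"
        using assms by (intro mult_left_le_one_le) auto
      have "(p - 1) / p \<le> (p - 1) / 1"
        using assms by (intro divide_left_mono) auto
      then show "(1 - 1 / p) * 1 \<le> p - 1"
        using assms by (simp add: diff_divide_distrib)
    qed
    finally show ?thesis .
  qed (use assms in auto)
  then show ?thesis
    using real assms by (simp add: ennpow_ennreal ennreal_plus[symmetric] del: ennreal_plus)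
qed (simp add: ennpow_top)

text \<open>The coefficient is the weight with \<open>p = (1 - \<theta>) * 1 + \<theta> * r\<close>;
  weighted Young then separates \<open>t^p\<close> into its powers of order 1 and \<open>r\<close>.
  The weight tends to 0 as \<open>p\<close> tends to 1, which makes the last term an error
  term.\<close>

lemma ennpow_interpolate:
  assumes "1 < p" "p < r"
  shows "ennpow a p \<le> a + ennreal ((p - 1) / (r - 1)) * ennpow a r"
proof (cases a)
  case (real t)
  define \<theta> where "\<theta> = (p - 1) / (r - 1)"
  have th: "0 \<le> \<theta>" "\<theta> \<le> 1" using assms by (auto simp: \<theta>_def field_simps)
  have "\<theta> * (r - 1) = p - 1" using assms by (simp add: \<theta>_def)
  then have pe: "p = (1 - \<theta>) + r * \<theta>" by (simp add: algebra_simps)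
  have "t powr p \<le> t + \<theta> * t powr r"
  proof (cases "t = 0")
    case False
    then have "t > 0" using real by simp
    have "t powr p = t powr (1 - \<theta>) * (t powr r) powr \<theta>"
      by (subst pe) (simp add: powr_add powr_powr)
    also have "\<dots> \<le> (1 - \<theta>) * t + \<theta> * t powr r"
      using \<open>t > 0\<close> th by (intro Youngs_inequality_0) auto
    also have "\<dots> \<le> t + \<theta> * t powr r"
      using \<open>t > 0\<close> th by (simp add: algebra_simps)
    finally show ?thesis .
  qed (use assms in auto)
  then show ?thesis
    using real th unfolding \<theta>_def[symmetric]
    by (simp add: ennpow_ennreal ennreal_plus[symmetric] ennreal_mult[symmetric] del: ennreal_plus)
qed (simp add: ennpow_top)

text \<open>The constant \<open>L\<close> is that of the almost increasing quotient \<open>\<phi>(t) / t\<close>, the exponent \<open>q\<close> comes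
  from (Dec) and \<open>\<beta>\<close> from (A0). The property is inherited by powers, with \<open>q\<close> replaced by \<open>q * p\<close>.\<close>

definition doubling :: "real \<Rightarrow> real \<Rightarrow> real \<Rightarrow> (real \<Rightarrow> ennreal) \<Rightarrow> bool" where
  "doubling L q \<beta> f \<longleftrightarrow> f 0 = 0 \<and> f \<beta> \<le> 1 \<and> (\<forall>s t. 0 \<le> s \<and> s \<le> t \<longrightarrow> f s \<le> f t) \<and>
     (\<forall>t c. 0 \<le> t \<and> 1 \<le> c \<longrightarrow> ennreal c * f (t / (L * c)) \<le> f t) \<and>
     (\<forall>t c. 0 \<le> t \<and> 1 \<le> c \<longrightarrow> f (c * t) \<le> ennreal (c powr q) * f t)"

lemma doublingD:
  assumes "doubling L q \<beta> f"
  shows "f 0 = 0" "f \<beta> \<le> 1" "0 \<le> s \<Longrightarrow> s \<le> t \<Longrightarrow> f s \<le> f t"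
    "0 \<le> t \<Longrightarrow> 1 \<le> c \<Longrightarrow> ennreal c * f (t / (L * c)) \<le> f t"
    "0 \<le> t \<Longrightarrow> 1 \<le> c \<Longrightarrow> f (c * t) \<le> ennreal (c powr q) * f t"
  using assms unfolding doubling_def by blast+

lemma doubling_pow:
  assumes f: "doubling L q \<beta> f" and p: "1 \<le> p"
  shows "doubling L (q * p) \<beta> (\<lambda>t. ennpow (f t) p)"
  unfolding doubling_def
proof (intro conjI allI impI)
  show "ennpow (f 0) p = 0" using f p by (simp add: doublingD(1) ennpow_0)
  show "ennpow (f \<beta>) p \<le> 1"
    using ennpow_mono[OF doublingD(2)[OF f], of p] p ennpow_ennreal[of 1 p] by simp
  show "ennpow (f s) p \<le> ennpow (f t) p" if "0 \<le> s \<and> s \<le> t" for s t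
    using that p by (intro ennpow_mono doublingD(3)[OF f]) auto
  show "ennreal c * ennpow (f (t / (L * c))) p \<le> ennpow (f t) p" if "0 \<le> t \<and> 1 \<le> c" for t c
  proof -
    \<comment> \<open>Since \<open>c \<ge> 1\<close>, the factor \<open>c^p\<close> produced by the
      power dominates \<open>c\<close>; therefore the constant \<open>L\<close> does not change with
      \<open>p\<close>.\<close>
    have "c powr 1 \<le> c powr p" using that p by (intro powr_mono) auto
    then have "ennreal c * ennpow (f (t / (L * c))) p \<le> ennreal (c powr p) * ennpow (f (t / (L * c))) p"
      using that by (intro mult_right_mono ennreal_leI) auto
    also have "\<dots> = ennpow (ennreal c * f (t / (L * c))) p"
      using that by (simp add: ennpow_cmult)
    also have "\<dots> \<le> ennpow (f t) p"
      using that p by (intro ennpow_mono doublingD(4)[OF f]) auto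
    finally show ?thesis .
  qed
  show "ennpow (f (c * t)) p \<le> ennreal (c powr (q * p)) * ennpow (f t) p" if "0 \<le> t \<and> 1 \<le> c" for t c
  proof -
    have "ennpow (f (c * t)) p \<le> ennpow (ennreal (c powr q) * f t) p"
      using that p by (intro ennpow_mono doublingD(5)[OF f]) auto
    then show ?thesis
      using that by (simp add: ennpow_cmult powr_powr)
  qed
qed

text \<open>One summand absorbs the other: either \<open>a + b \<le> (1 + \<delta>) * a\<close> or
  \<open>a + b \<le> (1 + 1/\<delta>) * b\<close>. Monotonicity and the growth bound finish each
  case.\<close>

lemma doubling_add_le:
  assumes f: "doubling L q \<beta> f" and "0 \<le> a" "0 \<le> b" "0 < \<delta>"
  shows "f (a + b) \<le> ennreal ((1 + \<delta>) powr q) * f a + ennreal ((1 + 1 / \<delta>) powr q) * f b"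
proof (cases "b \<le> \<delta> * a")
  case True
  have "f (a + b) \<le> f ((1 + \<delta>) * a)"
    using assms True by (intro doublingD(3)[OF f]) (auto simp: algebra_simps)
  also have "\<dots> \<le> ennreal ((1 + \<delta>) powr q) * f a"
    using assms by (intro doublingD(5)[OF f]) auto
  finally show ?thesis by (rule order_trans) simp
next
  case False
  have "f (a + b) \<le> f ((1 + 1 / \<delta>) * b)"
    using assms False by (intro doublingD(3)[OF f]) (auto simp: field_simps)
  also have "\<dots> \<le> ennreal ((1 + 1 / \<delta>) powr q) * f b"
    using assms by (intro doublingD(5)[OF f]) auto
  finally show ?thesis by (rule order_trans) simp
qed

text \<open>Infinite values prevent plain cross-multiplication: \<open>y = top\<close> makes the
  right-hand side infinite, and a finite \<open>y\<close> excludes \<open>x = top\<close>.\<close>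

lemma ennreal_div_le_imp:
  assumes "0 < s" "0 < t" "x / ennreal s \<le> ennreal k * (y / ennreal t)" "0 < k"
  shows "x \<le> ennreal (k * s / t) * y"
proof (cases y)
  case (real b)
  show ?thesis
  proof (cases x)
    case (real a)
    then show ?thesis
      using assms \<open>y = ennreal b\<close> \<open>0 \<le> b\<close>
      by (simp add: divide_ennreal ennreal_mult[symmetric] field_simps)
  next
    case top
    then have "x / ennreal s = top" using assms by (simp add: ennreal_top_divide)
    then have "top \<le> ennreal (k * (b / t))"
      using assms real by (simp add: divide_ennreal ennreal_mult[symmetric])
    then show ?thesis by (simp add: top_unique)
  qed
next
  case top
  then show ?thesis using assms by (simp add: ennreal_mult_top)
qed

lemma doublingI:
  assumes "1 \<le> L" "mono_on {0..} f" "f 0 = 0" "f \<beta> \<le> 1"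
    and inc: "almost_increasing L (\<lambda>t. f t / ennreal t)"
    and dec: "\<forall>s t. 0 < s \<and> s \<le> t \<longrightarrow> f t / ennreal (t powr q) \<le> f s / ennreal (s powr q)"
  shows "doubling L q \<beta> f"
  unfolding doubling_def
proof (intro conjI allI impI)
  show "f s \<le> f t" if "0 \<le> s \<and> s \<le> t" for s t
    using assms(2) that by (auto simp: mono_on_def)
  show "ennreal c * f (t / (L * c)) \<le> f t" if tc: "0 \<le> t \<and> 1 \<le> c" for t c
  proof (cases "t = 0")
    case False
    then have pos: "0 < t" "0 < c" "0 < L" using tc assms(1) by auto
    have "1 \<le> L * c" using assms(1) tc mult_mono[of 1 L 1 c] by simp
    then have "t / (L * c) \<le> t" using pos by (simp add: divide_le_eq)
    \<comment> \<open>The quotient condition is compared at \<open>t / (L * c)\<close> and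
      \<open>t\<close>. Dividing by \<open>L\<close> in addition to \<open>c\<close> cancels the
      constant of almost monotonicity, leaving exactly the factor \<open>1 / c\<close>.\<close>
    then have "f (t / (L * c)) \<le> ennreal (L * (t / (L * c)) / t) * f t"
      using inc pos by (intro ennreal_div_le_imp) (auto simp: almost_increasing_def)
    also have "L * (t / (L * c)) / t = 1 / c" using pos by simp
    finally have "ennreal c * f (t / (L * c)) \<le> ennreal c * (ennreal (1 / c) * f t)"
      by (rule mult_left_mono) simp
    also have "\<dots> = f t" using pos by (simp add: mult.assoc[symmetric] ennreal_mult[symmetric])
    finally show ?thesis .
  qed (simp add: assms(3))
  show "f (c * t) \<le> ennreal (c powr q) * f t" if tc: "0 \<le> t \<and> 1 \<le> c" for t c
  proof (cases "t = 0")
    case False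
    then have pos: "0 < t" "0 < c" using tc by auto
    have "f (c * t) / ennreal ((c * t) powr q) \<le> ennreal 1 * (f t / ennreal (t powr q))"
      using dec pos tc by (simp add: mult_right_mono)
    then have "f (c * t) \<le> ennreal (1 * (c * t) powr q / t powr q) * f t"
      using pos by (intro ennreal_div_le_imp) auto
    also have "1 * (c * t) powr q / t powr q = c powr q"
      using pos by (simp add: powr_mult)
    finally show ?thesis .
  qed (simp add: assms(3))
qed (use assms in auto)

section \<open>Small perturbations of extended real quantities\<close>

lemma ennreal_tendsto_0_iff:
  "((X :: 'b \<Rightarrow> ennreal) \<longlongrightarrow> 0) F \<longleftrightarrow> (\<forall>e>0. \<forall>\<^sub>F i in F. X i < ennreal e)"
proof
  assume "(X \<longlongrightarrow> 0) F"
  then show "\<forall>e>0. \<forall>\<^sub>F i in F. X i < ennreal e"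
    by (auto intro!: order_tendstoD(2) simp: ennreal_less_zero_iff)
next
  assume *: "\<forall>e>0. \<forall>\<^sub>F i in F. X i < ennreal e"
  show "(X \<longlongrightarrow> 0) F"
  proof (rule order_tendstoI)
    fix a :: ennreal assume "0 < a"
    then obtain b where b: "0 < b" "b < a" using dense by blast
    then obtain e where "b = ennreal e" by (cases b) auto
    with b have e: "0 < e" "ennreal e < a" by (auto simp: ennreal_less_zero_iff)
    then show "\<forall>\<^sub>F i in F. X i < a"
      using *[rule_format, OF e(1)] by (auto elim!: eventually_mono)
  qed simp
qed

text \<open>The order of choices matters: \<open>\<delta>\<close> is fixed first, so that the factor
  of \<open>V\<close> costs less than \<open>\<epsilon> / 2\<close>. The factor of \<open>W\<close>
  may be huge, but it is then a fixed number and a small \<open>W\<close> compensates for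
  it.\<close>

lemma quasi_triangle_perturb:
  fixes V q \<epsilon> :: real
  assumes "0 \<le> V" "0 < q" "0 < \<epsilon>"
  shows "\<exists>\<delta>>0. \<exists>\<eta>>0. \<forall>W. 0 \<le> W \<and> W < \<eta> \<longrightarrow> (1 + \<delta>) powr q * V + (1 + 1 / \<delta>) powr q * W \<le> V + \<epsilon>"
proof -
  have "((\<lambda>\<delta>. (1 + \<delta>) powr q * V) \<longlongrightarrow> (1 + 0) powr q * V) (at_right 0)"
    by (intro tendsto_intros) auto
  then have "\<forall>\<^sub>F \<delta> in at_right 0. (1 + \<delta>) powr q * V < V + \<epsilon> / 2"
    using assms by (intro order_tendstoD(2)) auto
  then have "\<forall>\<^sub>F \<delta> in at_right (0::real). (1 + \<delta>) powr q * V < V + \<epsilon> / 2 \<and> 0 < \<delta>"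
    by (intro eventually_conj eventually_at_right_less)
  then obtain \<delta> where d: "(1 + \<delta>) powr q * V < V + \<epsilon> / 2" "0 < \<delta>"
    using eventually_happens[of _ "at_right (0::real)"] by fastforce
  define C where "C = (1 + 1 / \<delta>) powr q"
  have "0 < 1 + 1 / \<delta>" using d(2) by (simp add: add_pos_pos)
  then have C: "0 < C" by (simp add: C_def)
  have "(1 + \<delta>) powr q * V + C * W \<le> V + \<epsilon>" if "0 \<le> W \<and> W < \<epsilon> / (2 * C)" for W
  proof -
    have "C * W \<le> \<epsilon> / 2" using that C by (simp add: field_simps)
    then show ?thesis using d by simp
  qed
  moreover have "0 < \<epsilon> / (2 * C)" using C assms by simp
  ultimately show ?thesis using d(2) unfolding C_def by blast
qed

lemma quasi_triangle_perturb_ennreal: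
  fixes V :: ennreal
  assumes "V < top" "0 < q" "0 < \<epsilon>"
  shows "\<exists>\<delta>>0. \<exists>\<eta>>0. \<forall>W. W < ennreal \<eta> \<longrightarrow>
    ennreal ((1 + \<delta>) powr q) * V + ennreal ((1 + 1 / \<delta>) powr q) * W \<le> V + ennreal \<epsilon>"
proof -
  obtain v where v: "V = ennreal v" "0 \<le> v" using assms(1) by (cases V) auto
  obtain \<delta> \<eta> where d: "0 < \<delta>" "0 < \<eta>"
    "\<And>W. 0 \<le> W \<Longrightarrow> W < \<eta> \<Longrightarrow> (1 + \<delta>) powr q * v + (1 + 1 / \<delta>) powr q * W \<le> v + \<epsilon>"
    using quasi_triangle_perturb[OF v(2) assms(2,3)] by blast
  have "ennreal ((1 + \<delta>) powr q) * V + ennreal ((1 + 1 / \<delta>) powr q) * W \<le> V + ennreal \<epsilon>"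
    if W: "W < ennreal \<eta>" for W
  proof -
    obtain w where w: "W = ennreal w" "0 \<le> w" using W by (cases W) auto
    then have "w < \<eta>" using W by (simp add: ennreal_less_iff)
    then show ?thesis using d(3)[of w] w v assms(3)
      by (simp add: ennreal_mult[symmetric] ennreal_plus[symmetric] del: ennreal_plus)
  qed
  then show ?thesis using d(1,2) by blast
qed

section \<open>Modulars, norms and energy classes of doubling integrands\<close>

text \<open>The locale is instantiated at \<open>\<phi>\<close> and at its powers
  \<open>phi_pow \<phi> p\<close>, so each estimate is proved once and available for all these
  integrands, with only \<open>q\<close> changing.\<close>

locale doubling_phi =
  fixes \<Omega> :: "(real^'n::finite) set" and \<phi> :: "'n phi" and L q \<beta> :: real
  assumes open_dom: "open \<Omega>" and bounded_dom: "bounded \<Omega>"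
    and phi_measurable: "\<And>h. h \<in> borel_measurable (lebesgue_on \<Omega>) \<Longrightarrow> (\<And>y. 0 \<le> h y) \<Longrightarrow>
      (\<lambda>y. \<phi> y (h y)) \<in> borel_measurable (lebesgue_on \<Omega>)"
    and L_ge_1: "1 \<le> L" and q_pos: "0 < q" and beta_pos: "0 < \<beta>"
    and AE_doubling: "AE x in lebesgue_on \<Omega>. doubling L q \<beta> (\<phi> x)"
begin

lemma emeasure_dom: "emeasure (lebesgue_on \<Omega>) (space (lebesgue_on \<Omega>)) < top"
proof -
  have "emeasure lborel \<Omega> < \<infinity>"
    using bounded_dom by (rule emeasure_bounded_finite)
  then show ?thesis
    using open_dom by (simp add: emeasure_restrict_space space_restrict_space)
qed

lemma phi_norm_measurable:
  assumes "v \<in> borel_measurable (lebesgue_on \<Omega>)"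
  shows "(\<lambda>x. \<phi> x (norm (v x))) \<in> borel_measurable (lebesgue_on \<Omega>)"
  using assms by (intro phi_measurable) auto

lemma modular_mono_AE:
  assumes "AE x in lebesgue_on \<Omega>. norm (v x) \<le> norm (w x)"
  shows "modular \<Omega> \<phi> v \<le> modular \<Omega> \<phi> w"
  unfolding modular_def
  by (rule nn_integral_mono_AE) (use AE_doubling assms in \<open>eventually_elim, auto intro: doublingD(3)\<close>)

lemma modular_cong_AE:
  assumes "AE x in lebesgue_on \<Omega>. v x = w x"
  shows "modular \<Omega> \<phi> v = modular \<Omega> \<phi> w"
  unfolding modular_def
  by (rule nn_integral_cong_AE) (use assms in \<open>eventually_elim, auto\<close>)

lemma modular_shrink:
  assumes [measurable]: "v \<in> borel_measurable (lebesgue_on \<Omega>)" and c: "1 \<le> c"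
  shows "ennreal c * modular \<Omega> \<phi> (\<lambda>x. v x /\<^sub>R (L * c)) \<le> modular \<Omega> \<phi> v"
proof -
  have *: "(\<lambda>x. v x /\<^sub>R (L * c)) \<in> borel_measurable (lebesgue_on \<Omega>)" by measurable
  have "ennreal c * modular \<Omega> \<phi> (\<lambda>x. v x /\<^sub>R (L * c)) =
      (\<integral>\<^sup>+x. ennreal c * \<phi> x (norm (v x /\<^sub>R (L * c))) \<partial>lebesgue_on \<Omega>)"
    unfolding modular_def by (rule nn_integral_cmult[symmetric]) (rule phi_norm_measurable[OF *])
  also have "\<dots> \<le> modular \<Omega> \<phi> v"
    unfolding modular_def
  proof (rule nn_integral_mono_AE, use AE_doubling in eventually_elim)
    case (elim x)
    have "norm (v x /\<^sub>R (L * c)) = norm (v x) / (L * c)"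
      using c L_ge_1 by (simp add: divide_inverse)
    then show ?case using doublingD(4)[OF elim, of "norm (v x)" c] c by simp
  qed
  finally show ?thesis .
qed

lemma modular_stretch:
  assumes [measurable]: "v \<in> borel_measurable (lebesgue_on \<Omega>)" and c: "1 \<le> c"
  shows "modular \<Omega> \<phi> (\<lambda>x. c *\<^sub>R v x) \<le> ennreal (c powr q) * modular \<Omega> \<phi> v"
proof -
  have "modular \<Omega> \<phi> (\<lambda>x. c *\<^sub>R v x) \<le> (\<integral>\<^sup>+x. ennreal (c powr q) * \<phi> x (norm (v x)) \<partial>lebesgue_on \<Omega>)"
    unfolding modular_def
  proof (rule nn_integral_mono_AE, use AE_doubling in eventually_elim)
    case (elim x)
    then show ?case using doublingD(5)[OF elim, of "norm (v x)" c] c by simp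
  qed
  also have "\<dots> = ennreal (c powr q) * modular \<Omega> \<phi> v"
    unfolding modular_def by (rule nn_integral_cmult) (rule phi_norm_measurable, simp)
  finally show ?thesis .
qed

lemma modular_add_le:
  assumes [measurable]: "v \<in> borel_measurable (lebesgue_on \<Omega>)" "w \<in> borel_measurable (lebesgue_on \<Omega>)"
    and d: "0 < \<delta>"
  shows "modular \<Omega> \<phi> (\<lambda>x. v x + w x) \<le>
    ennreal ((1 + \<delta>) powr q) * modular \<Omega> \<phi> v + ennreal ((1 + 1 / \<delta>) powr q) * modular \<Omega> \<phi> w"
proof -
  have m: "(\<lambda>x. \<phi> x (norm (v x))) \<in> borel_measurable (lebesgue_on \<Omega>)"
    "(\<lambda>x. \<phi> x (norm (w x))) \<in> borel_measurable (lebesgue_on \<Omega>)"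
    by (auto intro: phi_norm_measurable)
  have "modular \<Omega> \<phi> (\<lambda>x. v x + w x) \<le> (\<integral>\<^sup>+x. ennreal ((1 + \<delta>) powr q) * \<phi> x (norm (v x)) +
      ennreal ((1 + 1 / \<delta>) powr q) * \<phi> x (norm (w x)) \<partial>lebesgue_on \<Omega>)"
    unfolding modular_def
  proof (rule nn_integral_mono_AE, use AE_doubling in eventually_elim)
    case (elim x)
    have "\<phi> x (norm (v x + w x)) \<le> \<phi> x (norm (v x) + norm (w x))"
      by (rule doublingD(3)[OF elim]) (auto intro: norm_triangle_ineq)
    also have "\<dots> \<le> ennreal ((1 + \<delta>) powr q) * \<phi> x (norm (v x)) +
      ennreal ((1 + 1 / \<delta>) powr q) * \<phi> x (norm (w x))"
      by (rule doubling_add_le[OF elim]) (use d in auto)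
    finally show ?case .
  qed
  also have "\<dots> = ennreal ((1 + \<delta>) powr q) * modular \<Omega> \<phi> v + ennreal ((1 + 1 / \<delta>) powr q) * modular \<Omega> \<phi> w"
    unfolding modular_def using m by (simp add: nn_integral_add nn_integral_cmult)
  finally show ?thesis .
qed

lemma phi_norm_lessE:
  assumes "phi_norm \<Omega> \<psi> v < a"
  obtains lam where "0 < lam" "ennreal lam < a" "modular \<Omega> \<psi> (\<lambda>x. v x /\<^sub>R lam) \<le> 1"
  using assms unfolding phi_norm_def by (auto simp: Inf_less_iff)

lemma phi_norm_le:
  "0 < lam \<Longrightarrow> modular \<Omega> \<psi> (\<lambda>x. v x /\<^sub>R lam) \<le> 1 \<Longrightarrow> phi_norm \<Omega> \<psi> v \<le> ennreal lam"
  unfolding phi_norm_def by (auto intro: Inf_lower)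

lemma modular_scaled_le_1:
  assumes v: "v \<in> borel_measurable (lebesgue_on \<Omega>)" and "1 \<le> c" "modular \<Omega> \<phi> v \<le> ennreal c"
  shows "modular \<Omega> \<phi> (\<lambda>x. v x /\<^sub>R (L * c)) \<le> 1"
proof -
  have "ennreal c * modular \<Omega> \<phi> (\<lambda>x. v x /\<^sub>R (L * c)) \<le> ennreal c * 1"
    using modular_shrink[OF v assms(2)] assms(3) by simp
  then show ?thesis
    using assms(2) by (subst (asm) ennreal_mult_le_mult_iff) auto
qed

text \<open>A finite norm makes some rescaled modular finite, and the growth bound undoes the
  scaling at a finite cost. Conversely, dividing by \<open>L * max 1 m\<close> brings a modular of
  size \<open>m\<close> below 1.\<close>

lemma phi_norm_finite_iff:
  assumes v [measurable]: "v \<in> borel_measurable (lebesgue_on \<Omega>)"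
  shows "phi_norm \<Omega> \<phi> v < top \<longleftrightarrow> modular \<Omega> \<phi> v < top"
proof
  assume "phi_norm \<Omega> \<phi> v < top"
  then obtain lam where lam: "0 < lam" "modular \<Omega> \<phi> (\<lambda>x. v x /\<^sub>R lam) \<le> 1"
    by (rule phi_norm_lessE)
  \<comment> \<open>The growth bound concerns factors of at least 1, whereas \<open>lam\<close> may
    be smaller; by monotonicity the larger factor does no harm.\<close>
  define c where "c = max 1 lam"
  have "modular \<Omega> \<phi> v \<le> modular \<Omega> \<phi> (\<lambda>x. c *\<^sub>R (v x /\<^sub>R lam))"
  proof (rule modular_mono_AE, rule AE_I2)
    fix x
    have "1 * norm (v x) \<le> (c / lam) * norm (v x)"
      using lam by (intro mult_right_mono) (auto simp: c_def)
    then show "norm (v x) \<le> norm (c *\<^sub>R (v x /\<^sub>R lam))"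
      using lam by (simp add: c_def divide_inverse mult.assoc)
  qed
  also have "\<dots> \<le> ennreal (c powr q) * modular \<Omega> \<phi> (\<lambda>x. v x /\<^sub>R lam)"
    by (rule modular_stretch) (auto simp: c_def)
  also have "\<dots> \<le> ennreal (c powr q) * 1"
    using lam by (intro mult_left_mono) auto
  also have "\<dots> < top" by simp
  finally show "modular \<Omega> \<phi> v < top" .
next
  assume "modular \<Omega> \<phi> v < top"
  then obtain m where m: "modular \<Omega> \<phi> v = ennreal m" "0 \<le> m"
    by (cases "modular \<Omega> \<phi> v") auto
  have "phi_norm \<Omega> \<phi> v \<le> ennreal (L * max 1 m)"
    by (rule phi_norm_le[OF _ modular_scaled_le_1[OF v]]) (use L_ge_1 m in \<open>auto simp: ennreal_leI\<close>)
  also have "\<dots> < top" by simp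
  finally show "phi_norm \<Omega> \<phi> v < top" .
qed

text \<open>A substitute for the convex estimate of the modular by the norm, at the price of the
  factor \<open>L\<close>. With \<open>c = 1 / (L * \<epsilon>)\<close> the shrinking inequality
  divides by \<open>L * c = 1 / \<epsilon>\<close>, which still leaves a function at least as large
  as \<open>v\<close> because \<open>lam < \<epsilon>\<close>; the condition
  \<open>L * \<epsilon> \<le> 1\<close> says that \<open>c \<ge> 1\<close>.\<close>

lemma modular_le_phi_norm:
  assumes v [measurable]: "v \<in> borel_measurable (lebesgue_on \<Omega>)"
    and "phi_norm \<Omega> \<phi> v < ennreal \<epsilon>" "L * \<epsilon> \<le> 1" "0 < \<epsilon>"
  shows "modular \<Omega> \<phi> v \<le> ennreal (L * \<epsilon>)"
proof -
  obtain lam where lam: "0 < lam" "ennreal lam < ennreal \<epsilon>" "modular \<Omega> \<phi> (\<lambda>x. v x /\<^sub>R lam) \<le> 1"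
    using assms(2) by (rule phi_norm_lessE)
  have "lam < \<epsilon>" using lam by (simp add: ennreal_less_iff)
  have pos: "0 < L" using L_ge_1 by simp
  define c where "c = 1 / (L * \<epsilon>)"
  have c: "1 \<le> c" "0 < c" using assms pos by (auto simp: c_def field_simps)
  have "modular \<Omega> \<phi> v \<le> modular \<Omega> \<phi> (\<lambda>x. (v x /\<^sub>R lam) /\<^sub>R (L * c))"
  proof (rule modular_mono_AE, rule AE_I2)
    fix x
    have "L * c = 1 / \<epsilon>" using pos by (simp add: c_def)
    then have "norm ((v x /\<^sub>R lam) /\<^sub>R (L * c)) = (\<epsilon> / lam) * norm (v x)"
      using lam assms by (simp add: divide_inverse)
    moreover have "1 * norm (v x) \<le> (\<epsilon> / lam) * norm (v x)"
      using lam \<open>lam < \<epsilon>\<close> by (intro mult_right_mono) auto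
    ultimately show "norm (v x) \<le> norm ((v x /\<^sub>R lam) /\<^sub>R (L * c))" by simp
  qed
  then have "ennreal c * modular \<Omega> \<phi> v \<le> ennreal c * modular \<Omega> \<phi> (\<lambda>x. (v x /\<^sub>R lam) /\<^sub>R (L * c))"
    by (rule mult_left_mono) simp
  also have "\<dots> \<le> modular \<Omega> \<phi> (\<lambda>x. v x /\<^sub>R lam)"
    by (rule modular_shrink) (use c in auto)
  finally have "ennreal c * modular \<Omega> \<phi> v \<le> 1" using lam by simp
  then have "ennreal (L * \<epsilon>) * (ennreal c * modular \<Omega> \<phi> v) \<le> ennreal (L * \<epsilon>) * 1"
    by (rule mult_left_mono) simp
  moreover have "ennreal (L * \<epsilon>) * (ennreal c * modular \<Omega> \<phi> v) = modular \<Omega> \<phi> v"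
    using assms pos c by (simp add: mult.assoc[symmetric] ennreal_mult[symmetric] c_def)
  ultimately show ?thesis by simp
qed

lemma modular_perturb:
  assumes v: "v \<in> borel_measurable (lebesgue_on \<Omega>)" and "modular \<Omega> \<phi> v < top" "0 < \<epsilon>"
  shows "\<exists>\<eta>>0. \<forall>w \<in> borel_measurable (lebesgue_on \<Omega>). phi_norm \<Omega> \<phi> w < ennreal \<eta> \<longrightarrow>
    modular \<Omega> \<phi> (\<lambda>x. v x + w x) \<le> modular \<Omega> \<phi> v + ennreal \<epsilon>"
proof -
  obtain \<delta> \<eta> where d: "0 < \<delta>" "0 < \<eta>" "\<And>W. W < ennreal \<eta> \<Longrightarrow>
      ennreal ((1 + \<delta>) powr q) * modular \<Omega> \<phi> v + ennreal ((1 + 1 / \<delta>) powr q) * W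
        \<le> modular \<Omega> \<phi> v + ennreal \<epsilon>"
    using quasi_triangle_perturb_ennreal[OF assms(2) q_pos assms(3)] by blast
  \<comment> \<open>The first bound is the smallness condition for estimating the modular by the
    norm. The second brings that modular strictly below the tolerance \<open>\<eta>\<close>, whence
    the factor 2.\<close>
  define e where "e = min (1 / L) (\<eta> / (2 * L))"
  have pos: "0 < L" using L_ge_1 by simp
  have e: "0 < e" "L * e \<le> 1" "L * e < \<eta>"
    using pos d(2) by (auto simp: e_def min_def field_simps)
  have "modular \<Omega> \<phi> (\<lambda>x. v x + w x) \<le> modular \<Omega> \<phi> v + ennreal \<epsilon>"
    if w: "w \<in> borel_measurable (lebesgue_on \<Omega>)" "phi_norm \<Omega> \<phi> w < ennreal e" for w
  proof -
    have "modular \<Omega> \<phi> w \<le> ennreal (L * e)"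
      by (rule modular_le_phi_norm[OF w e(2,1)])
    also have "\<dots> < ennreal \<eta>" using e pos by (simp add: ennreal_less_iff)
    finally show ?thesis
      by (rule order_trans[OF modular_add_le[OF v w(1) d(1)] d(3)])
  qed
  then show ?thesis using e(1) by blast
qed

text \<open>The \<open>L1\<close> part of the norm is automatically finite on \<open>W11\<close>, so
  membership is a condition on the energy alone.\<close>

lemma L1phi_iff:
  "L1phi \<Omega> \<phi> u \<longleftrightarrow> W11 \<Omega> u \<and> modular \<Omega> \<phi> (wgrad \<Omega> u) < top"
proof -
  have "L1_norm \<Omega> u < top" if "W11 \<Omega> u"
    using W11_imp_L1[OF that] unfolding L1_norm_def L1_def integrable_iff_bounded by simp
  then show ?thesis
    unfolding L1phi_def L1phi_norm_def
    using phi_norm_finite_iff[OF wgrad_measurable] by auto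
qed

text \<open>The gradient of \<open>w\<close> is bounded by some \<open>B\<close> on the compact
  closure. The bound at \<open>\<beta>\<close> coming from (A0), stretched from
  \<open>\<beta>\<close> to \<open>B\<close> by the growth bound, controls the integrand uniformly
  in \<open>x\<close>, and the domain has finite measure.\<close>

lemma modular_smooth_finite:
  assumes w: "smooth w" and vw: "\<And>x. x \<in> \<Omega> \<Longrightarrow> v x = w x"
  shows "modular \<Omega> \<phi> (wgrad \<Omega> v) < top"
proof -
  let ?g = "\<lambda>x. \<chi> i. pderiv i w x"
  have "compact (?g ` closure \<Omega>)"
    using bounded_dom w
    by (intro compact_continuous_image continuous_intros smooth_continuous_on smooth_pderiv) auto
  then obtain B where B: "\<And>y. y \<in> ?g ` closure \<Omega> \<Longrightarrow> norm y \<le> B"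
    by (meson compact_imp_bounded bounded_iff)
  define c where "c = max 1 (B / \<beta>)"
  have c: "1 \<le> c" "B \<le> c * \<beta>"
    using beta_pos by (auto simp: c_def max_def field_simps)
  have "AE x in lebesgue_on \<Omega>. x \<in> \<Omega>"
    using AE_space[of "lebesgue_on \<Omega>"] by simp
  moreover have "AE x in lebesgue_on \<Omega>. wgrad \<Omega> v x = ?g x"
    by (rule AE_wgrad_eq[OF open_dom weak_grad_smooth[OF open_dom bounded_dom w vw]])
  ultimately have "AE x in lebesgue_on \<Omega>. \<phi> x (norm (wgrad \<Omega> v x)) \<le> ennreal (c powr q)"
    using AE_doubling
  proof eventually_elim
    case (elim x)
    have "norm (wgrad \<Omega> v x) \<le> B"
      using elim closure_subset[of \<Omega>] by (auto intro!: B)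
    then have "\<phi> x (norm (wgrad \<Omega> v x)) \<le> \<phi> x (c * \<beta>)"
      using c by (intro doublingD(3)[OF elim(3)]) auto
    also have "\<dots> \<le> ennreal (c powr q) * \<phi> x \<beta>"
      using c beta_pos by (intro doublingD(5)[OF elim(3)]) auto
    also have "\<dots> \<le> ennreal (c powr q) * 1"
      by (intro mult_left_mono doublingD(2)[OF elim(3)]) auto
    finally show ?case by simp
  qed
  then have "modular \<Omega> \<phi> (wgrad \<Omega> v) \<le> (\<integral>\<^sup>+x. ennreal (c powr q) \<partial>lebesgue_on \<Omega>)"
    unfolding modular_def by (rule nn_integral_mono_AE)
  also have "\<dots> < top"
    using emeasure_dom by (simp add: ennreal_mult_less_top del: space_restrict_space)
  finally show ?thesis .
qed

lemma L1phi_smooth: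
  assumes w: "smooth w" and vw: "\<And>x. x \<in> \<Omega> \<Longrightarrow> v x = w x"
  shows "L1phi \<Omega> \<phi> v"
  unfolding L1phi_iff
  using weak_grad_smooth[OF open_dom bounded_dom w vw] modular_smooth_finite[OF w vw]
  by (auto simp: W11_def)

lemma L1phi_norm_0: "L1phi_norm \<Omega> \<phi> (\<lambda>x. 0) = 0"
proof -
  have g: "weak_grad \<Omega> (\<lambda>x. 0) (\<lambda>x. 0)"
    by (auto simp: weak_grad_def L1_def)
  have "AE x in lebesgue_on \<Omega>. wgrad \<Omega> (\<lambda>x. 0) x = 0"
    by (rule AE_wgrad_eq[OF open_dom g])
  then have "AE x in lebesgue_on \<Omega>. \<phi> x (norm (wgrad \<Omega> (\<lambda>x. 0) x /\<^sub>R lam)) = 0" for lam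
    using AE_doubling by eventually_elim (simp add: doublingD(1))
  then have *: "modular \<Omega> \<phi> (\<lambda>x. wgrad \<Omega> (\<lambda>x. 0) x /\<^sub>R lam) = 0" for lam
    unfolding modular_def by (subst nn_integral_cong_AE[where v = "\<lambda>x. 0"]) auto
  have "phi_norm \<Omega> \<phi> (wgrad \<Omega> (\<lambda>x. 0)) = 0"
  proof (rule antisym[OF ennreal_le_epsilon])
    fix e :: real assume "0 < e"
    then show "phi_norm \<Omega> \<phi> (wgrad \<Omega> (\<lambda>x. 0)) \<le> 0 + ennreal e"
      using phi_norm_le[of e \<phi>] * by simp
  qed auto
  then show ?thesis
    using g by (auto simp: L1phi_norm_def W11_def L1_norm_def)
qed

lemma L1phi0_test_fun:
  assumes "test_fun \<Omega> \<xi>"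
  shows "L1phi0 \<Omega> \<phi> \<xi>"
  unfolding L1phi0_def
proof (intro conjI exI[of _ "\<lambda>_. \<xi>"])
  show "L1phi \<Omega> \<phi> \<xi>"
    by (rule L1phi_smooth[OF test_fun_smooth[OF assms]]) simp
qed (use assms L1phi_norm_0 in simp_all)

end

subsection \<open>Recovery sequences and perturbation of energies\<close>

text \<open>Diagonal extraction in abstract form, with \<open>d\<close> as the distance to the
  target, so that it serves both functionals.\<close>

lemma recovery_sequence:
  fixes Gp :: "nat \<Rightarrow> 'a \<Rightarrow> ennreal" and d :: "'a \<Rightarrow> ennreal"
  assumes "\<And>\<epsilon>. 0 < \<epsilon> \<Longrightarrow> \<exists>v. X v \<and> d v < ennreal \<epsilon> \<and> (\<forall>\<^sub>F i in sequentially. Gp i v \<le> G + ennreal \<epsilon>)"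
  shows "\<exists>us. (\<forall>i. X (us i)) \<and> (\<lambda>i. d (us i)) \<longlonglongrightarrow> 0 \<and> limsup (\<lambda>i. Gp i (us i)) \<le> G"
proof -
  define e where "e k = 1 / real (Suc k)" for k
  have e: "0 < e k" for k by (simp add: e_def)
  have e_anti: "e l \<le> e k" if "k \<le> l" for k l
    using that unfolding e_def by (intro divide_left_mono) auto
  have e0: "\<exists>k. e k < \<epsilon>" if "0 < \<epsilon>" for \<epsilon>
    using reals_Archimedean[OF that] by (auto simp: e_def inverse_eq_divide)
  have "\<forall>k. \<exists>v. X v \<and> d v < ennreal (e k) \<and> (\<forall>\<^sub>F i in sequentially. Gp i v \<le> G + ennreal (e k))"
    using assms[OF e] by blast
  from choice[OF this] obtain v where v: "\<And>k. X (v k)" "\<And>k. d (v k) < ennreal (e k)"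
    "\<And>k. \<forall>\<^sub>F i in sequentially. Gp i (v k) \<le> G + ennreal (e k)"
    by blast
  have "\<forall>k. \<exists>N. \<forall>i\<ge>N. Gp i (v k) \<le> G + ennreal (e k)"
    using v(3) unfolding eventually_sequentially by blast
  from choice[OF this] obtain N where N: "\<And>k i. N k \<le> i \<Longrightarrow> Gp i (v k) \<le> G + ennreal (e k)"
    by blast
  \<comment> \<open>\<open>m i\<close> will be the largest index whose threshold \<open>N\<close>
    has been passed by \<open>i\<close>; the bound \<open>k \<le> i\<close> keeps the set finite.
    The default value 0 is used only for the finitely many \<open>i\<close> below
    \<open>N 0\<close>.\<close>
  define K where "K i = {k. k \<le> i \<and> N k \<le> i}" for i
  define m where "m i = (if K i = {} then 0 else Max (K i))" for i
  have fin: "finite (K i)" for i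
    by (rule finite_subset[of _ "{..i}"]) (auto simp: K_def)
  have m: "k \<le> m i \<and> m i \<in> K i" if "k \<le> i" "N k \<le> i" for k i
  proof -
    have "k \<in> K i" using that by (simp add: K_def)
    then have "m i = Max (K i)" "K i \<noteq> {}" by (auto simp: m_def)
    then show ?thesis using Max_in[OF fin] Max_ge[OF fin \<open>k \<in> K i\<close>] by simp
  qed
  have ev: "\<forall>\<^sub>F i in sequentially. k \<le> m i \<and> m i \<in> K i" for k
    by (rule eventually_sequentiallyI[of "max k (N k)"], rule m) simp_all
  have "(\<lambda>i. d (v (m i))) \<longlonglongrightarrow> 0"
    unfolding ennreal_tendsto_0_iff
  proof (intro allI impI)
    fix \<epsilon> :: real assume "0 < \<epsilon>"
    then obtain k where k: "e k < \<epsilon>" using e0 by blast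
    show "\<forall>\<^sub>F i in sequentially. d (v (m i)) < ennreal \<epsilon>"
      using ev[of k]
    proof eventually_elim
      case (elim i)
      have "ennreal (e (m i)) \<le> ennreal \<epsilon>"
        using e_anti[of k "m i"] elim k by (intro ennreal_leI) auto
      then show ?case by (rule less_le_trans[OF v(2)])
    qed
  qed
  moreover have "limsup (\<lambda>i. Gp i (v (m i))) \<le> G"
  proof (rule ennreal_le_epsilon)
    fix \<epsilon> :: real assume "0 < \<epsilon>"
    then obtain k where k: "e k < \<epsilon>" using e0 by blast
    have "\<forall>\<^sub>F i in sequentially. Gp i (v (m i)) \<le> G + ennreal \<epsilon>"
      using ev[of k]
    proof eventually_elim
      case (elim i)
      have "Gp i (v (m i)) \<le> G + ennreal (e (m i))"
        using elim by (intro N) (auto simp: K_def)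
      also have "\<dots> \<le> G + ennreal \<epsilon>"
        using e_anti[of k "m i"] elim k by (intro add_left_mono ennreal_leI) auto
      finally show ?case .
    qed
    then show "limsup (\<lambda>i. Gp i (v (m i))) \<le> G + ennreal \<epsilon>"
      by (rule Limsup_bounded)
  qed
  ultimately show ?thesis using v(1) by (intro exI[of _ "\<lambda>i. v (m i)"]) simp
qed

text \<open>The subsequence is shifted so that every value is finite, not only eventually: the
  relaxed functionals require each member of a competing sequence to be admissible.\<close>

lemma ennreal_liminf_subseq:
  fixes a :: "nat \<Rightarrow> ennreal"
  assumes "liminf a < top"
  shows "\<exists>k. strict_mono k \<and> (\<lambda>i. a (k i)) \<longlonglongrightarrow> liminf a \<and> (\<forall>i. a (k i) < top)"
proof -
  obtain k where k: "strict_mono k" "(a \<circ> k) \<longlonglongrightarrow> liminf a"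
    using liminf_subseq_lim[of a] by blast
  obtain N where N: "\<And>i. N \<le> i \<Longrightarrow> a (k i) < top"
    using order_tendstoD(2)[OF k(2) assms] unfolding eventually_sequentially by auto
  have "strict_mono (\<lambda>i. k (i + N))"
    using k(1) by (simp add: strict_mono_def)
  moreover have "(\<lambda>i. a (k (i + N))) \<longlonglongrightarrow> liminf a"
    using LIMSEQ_ignore_initial_segment[OF k(2), of N] by simp
  ultimately show ?thesis using N by (intro exI[of _ "\<lambda>i. k (i + N)"]) auto
qed

lemma ennreal_tendsto_mult_0:
  assumes "(x \<longlongrightarrow> 0) F" "\<And>i. 0 \<le> x i" "M < top"
  shows "((\<lambda>i. ennreal (x i) * M) \<longlongrightarrow> 0) F"
proof -
  obtain m where m: "M = ennreal m" "0 \<le> m" using assms(3) by (cases M) auto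
  have "((\<lambda>i. ennreal (x i * m)) \<longlongrightarrow> ennreal (0 * m)) F"
    by (intro tendsto_ennrealI tendsto_intros assms)
  then show ?thesis using m assms(2) by (simp add: ennreal_mult)
qed

lemma ennreal_less_add: "a < top \<Longrightarrow> 0 < \<epsilon> \<Longrightarrow> a < a + ennreal \<epsilon>"
  by (cases a) (auto simp: ennreal_plus[symmetric] ennreal_less_iff simp del: ennreal_plus)

lemma liminf_less_frequently:
  fixes a :: "nat \<Rightarrow> ennreal"
  assumes "liminf a < c" "\<forall>\<^sub>F i in sequentially. P i"
  shows "\<exists>i. a i < c \<and> P i"
proof (rule ccontr)
  assume "\<not> ?thesis"
  then have "\<forall>\<^sub>F i in sequentially. c \<le> a i"
    using assms(2) by (auto elim!: eventually_mono simp: not_less)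
  then have "c \<le> liminf a" by (rule Liminf_bounded)
  then show False using assms(1) by simp
qed

lemma L1_norm_add_le:
  assumes "L1 \<Omega> u" "L1 \<Omega> v"
  shows "L1_norm \<Omega> (\<lambda>x. u x + v x) \<le> L1_norm \<Omega> u + L1_norm \<Omega> v"
proof -
  have m: "u \<in> borel_measurable (lebesgue_on \<Omega>)" "v \<in> borel_measurable (lebesgue_on \<Omega>)"
    using assms by (auto simp: L1_def)
  have "L1_norm \<Omega> (\<lambda>x. u x + v x) \<le> (\<integral>\<^sup>+x. ennreal \<bar>u x\<bar> + ennreal \<bar>v x\<bar> \<partial>lebesgue_on \<Omega>)"
    unfolding L1_norm_def
    by (intro nn_integral_mono) (auto simp: ennreal_plus[symmetric] simp del: ennreal_plus intro!: ennreal_leI)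
  also have "\<dots> = L1_norm \<Omega> u + L1_norm \<Omega> v"
    unfolding L1_norm_def using m by (intro nn_integral_add) auto
  finally show ?thesis .
qed

text \<open>Passing to squared integrals allows the fidelity term to be handled by the same
  two-weight inequality as the energy, in place of Minkowski's inequality.\<close>

lemma L2_norm_less_iff:
  assumes "0 < e"
  shows "L2_norm \<Omega> b < ennreal e \<longleftrightarrow> (\<integral>\<^sup>+x. ennreal ((b x)\<^sup>2) \<partial>lebesgue_on \<Omega>) < ennreal (e\<^sup>2)"
proof (cases "\<integral>\<^sup>+x. ennreal ((b x)\<^sup>2) \<partial>lebesgue_on \<Omega>")
  case (real a)
  have "sqrt a < e \<longleftrightarrow> a < e\<^sup>2"
    using assms real real_sqrt_less_iff[of a "e\<^sup>2"] by simp
  then show ?thesis using real assms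
    by (simp add: L2_norm_def ennpow_ennreal powr_half_sqrt ennreal_less_iff)
qed (simp add: L2_norm_def ennpow_top)

text \<open>Pointwise, the right-hand side exceeds the left-hand side by
  \<open>(\<delta> * s - t)^2 / \<delta>\<close>. The weights have the form used for modulars, with
  exponent 1 in place of \<open>q\<close>.\<close>

lemma sq_integral_add_le:
  assumes [measurable]: "a \<in> borel_measurable M" "b \<in> borel_measurable M" and d: "0 < \<delta>"
  shows "(\<integral>\<^sup>+x. ennreal ((a x + b x :: real)\<^sup>2) \<partial>M) \<le>
    ennreal (1 + \<delta>) * (\<integral>\<^sup>+x. ennreal ((a x)\<^sup>2) \<partial>M) + ennreal (1 + 1 / \<delta>) * (\<integral>\<^sup>+x. ennreal ((b x)\<^sup>2) \<partial>M)"
proof -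
  have *: "(s + t)\<^sup>2 \<le> (1 + \<delta>) * s\<^sup>2 + (1 + 1 / \<delta>) * t\<^sup>2" for s t :: real
  proof -
    have "0 \<le> (\<delta> * s - t)\<^sup>2 / \<delta>" using d by simp
    also have "\<dots> = (1 + \<delta>) * s\<^sup>2 + (1 + 1 / \<delta>) * t\<^sup>2 - (s + t)\<^sup>2"
      using d by (simp add: power2_eq_square field_simps)
    finally show ?thesis by simp
  qed
  have "(\<integral>\<^sup>+x. ennreal ((a x + b x)\<^sup>2) \<partial>M) \<le>
    (\<integral>\<^sup>+x. ennreal (1 + \<delta>) * ennreal ((a x)\<^sup>2) + ennreal (1 + 1 / \<delta>) * ennreal ((b x)\<^sup>2) \<partial>M)"
    using d * by (intro nn_integral_mono)
      (auto simp: ennreal_mult[symmetric] ennreal_plus[symmetric] simp del: ennreal_plus intro!: ennreal_leI)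
  also have "\<dots> = ennreal (1 + \<delta>) * (\<integral>\<^sup>+x. ennreal ((a x)\<^sup>2) \<partial>M) + ennreal (1 + 1 / \<delta>) * (\<integral>\<^sup>+x. ennreal ((b x)\<^sup>2) \<partial>M)"
    by (simp add: nn_integral_add nn_integral_cmult)
  finally show ?thesis .
qed

lemma sq_integral_perturb:
  assumes a: "a \<in> borel_measurable (lebesgue_on \<Omega>)"
    and "(\<integral>\<^sup>+x. ennreal ((a x)\<^sup>2) \<partial>lebesgue_on \<Omega>) < top" "0 < \<epsilon>"
  shows "\<exists>\<eta>>0. \<forall>b \<in> borel_measurable (lebesgue_on \<Omega>). L2_norm \<Omega> b < ennreal \<eta> \<longrightarrow>
    (\<integral>\<^sup>+x. ennreal ((a x + b x)\<^sup>2) \<partial>lebesgue_on \<Omega>) \<le>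
      (\<integral>\<^sup>+x. ennreal ((a x)\<^sup>2) \<partial>lebesgue_on \<Omega>) + ennreal \<epsilon>"
proof -
  let ?I = "\<lambda>b. \<integral>\<^sup>+x. ennreal ((b x)\<^sup>2) \<partial>lebesgue_on \<Omega>"
  obtain \<delta> \<eta> where d: "0 < \<delta>" "0 < \<eta>" "\<And>W. W < ennreal \<eta> \<Longrightarrow>
      ennreal ((1 + \<delta>) powr 1) * ?I a + ennreal ((1 + 1 / \<delta>) powr 1) * W \<le> ?I a + ennreal \<epsilon>"
    using quasi_triangle_perturb_ennreal[OF assms(2) zero_less_one assms(3)] by blast
  have "?I (\<lambda>x. a x + b x) \<le> ?I a + ennreal \<epsilon>"
    \<comment> \<open>The radius is a square root because the tolerance \<open>\<eta>\<close> refers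
      to the squared integral.\<close>
    if b: "b \<in> borel_measurable (lebesgue_on \<Omega>)" "L2_norm \<Omega> b < ennreal (sqrt \<eta>)" for b
  proof -
    have "?I b < ennreal \<eta>" using b(2) d(2) by (simp add: L2_norm_less_iff)
    from d(3)[OF this] show ?thesis
      using sq_integral_add_le[OF a b(1) d(1)] d(1) by (simp add: add_pos_pos)
  qed
  then show ?thesis using d(2) by (intro exI[of _ "sqrt \<eta>"]) auto
qed

section \<open>Comparison of \<open>\<phi>\<close> with its powers\<close>

context doubling_phi
begin

lemma doubling_phi_pow:
  assumes "1 \<le> p"
  shows "doubling_phi \<Omega> (phi_pow \<phi> p) L (q * p) \<beta>"
proof
  show "(\<lambda>y. phi_pow \<phi> p y (h y)) \<in> borel_measurable (lebesgue_on \<Omega>)"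
    if "h \<in> borel_measurable (lebesgue_on \<Omega>)" "\<And>y. 0 \<le> h y" for h
    unfolding phi_pow_def
    by (rule measurable_compose[OF phi_measurable ennpow_measurable]) (use that in auto)
  show "AE x in lebesgue_on \<Omega>. doubling L (q * p) \<beta> (phi_pow \<phi> p x)"
    using AE_doubling by eventually_elim (auto simp: phi_pow_def intro: doubling_pow assms)
qed (use open_dom bounded_dom L_ge_1 q_pos beta_pos assms in auto)

lemma modular_pow_interpolate:
  assumes p: "1 < p" "p < r" and v: "v \<in> borel_measurable (lebesgue_on \<Omega>)"
  shows "modular \<Omega> (phi_pow \<phi> p) v \<le>
    modular \<Omega> \<phi> v + ennreal ((p - 1) / (r - 1)) * modular \<Omega> (phi_pow \<phi> r) v"
proof -
  have [measurable]: "(\<lambda>x. \<phi> x (norm (v x))) \<in> borel_measurable (lebesgue_on \<Omega>)"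
    by (rule phi_norm_measurable[OF v])
  have "modular \<Omega> (phi_pow \<phi> p) v \<le> (\<integral>\<^sup>+x. \<phi> x (norm (v x)) +
      ennreal ((p - 1) / (r - 1)) * ennpow (\<phi> x (norm (v x))) r \<partial>lebesgue_on \<Omega>)"
    unfolding modular_def phi_pow_def
    by (intro nn_integral_mono ennpow_interpolate p)
  also have "\<dots> = modular \<Omega> \<phi> v + ennreal ((p - 1) / (r - 1)) * modular \<Omega> (phi_pow \<phi> r) v"
    unfolding modular_def phi_pow_def
    by (simp add: nn_integral_add nn_integral_cmult)
  finally show ?thesis .
qed

lemma modular_le_modular_pow:
  assumes p: "1 \<le> p" and v: "v \<in> borel_measurable (lebesgue_on \<Omega>)"
  shows "modular \<Omega> \<phi> v \<le> modular \<Omega> (phi_pow \<phi> p) v +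
    ennreal (p - 1) * emeasure (lebesgue_on \<Omega>) (space (lebesgue_on \<Omega>))"
proof -
  have [measurable]: "(\<lambda>x. \<phi> x (norm (v x))) \<in> borel_measurable (lebesgue_on \<Omega>)"
    by (rule phi_norm_measurable[OF v])
  have "modular \<Omega> \<phi> v \<le> (\<integral>\<^sup>+x. ennpow (\<phi> x (norm (v x))) p + ennreal (p - 1) \<partial>lebesgue_on \<Omega>)"
    unfolding modular_def by (intro nn_integral_mono le_ennpow_plus p)
  also have "\<dots> = modular \<Omega> (phi_pow \<phi> p) v +
    ennreal (p - 1) * emeasure (lebesgue_on \<Omega>) (space (lebesgue_on \<Omega>))"
    unfolding modular_def phi_pow_def
    by (simp add: nn_integral_add del: space_restrict_space)
  finally show ?thesis .
qed

lemma L1phi_pow_imp: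
  assumes "1 \<le> p" "L1phi \<Omega> (phi_pow \<phi> p) u"
  shows "L1phi \<Omega> \<phi> u"
proof -
  interpret P: doubling_phi \<Omega> "phi_pow \<phi> p" L "q * p" \<beta>
    by (rule doubling_phi_pow[OF assms(1)])
  have u: "W11 \<Omega> u" "modular \<Omega> (phi_pow \<phi> p) (wgrad \<Omega> u) < top"
    using assms(2) by (auto simp: P.L1phi_iff)
  have "modular \<Omega> \<phi> (wgrad \<Omega> u) \<le> modular \<Omega> (phi_pow \<phi> p) (wgrad \<Omega> u) +
    ennreal (p - 1) * emeasure (lebesgue_on \<Omega>) (space (lebesgue_on \<Omega>))"
    by (rule modular_le_modular_pow[OF assms(1) wgrad_measurable[OF u(1)]])
  also have "\<dots> < top"
    using u(2) emeasure_dom by (simp add: ennreal_mult_less_top del: space_restrict_space)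
  finally show ?thesis using u(1) by (simp add: L1phi_iff)
qed

text \<open>If \<open>v / lam\<close> has \<open>\<phi>^p\<close>-modular at most 1, its
  \<open>\<phi>\<close>-modular is at most \<open>c = 1 + (p - 1) * m\<close>, where
  \<open>m\<close> is the measure of the domain. A further division by \<open>L * c\<close> brings
  it back to 1, so \<open>K = L * c\<close> works.\<close>

lemma phi_norm_le_phi_norm_pow:
  assumes p: "1 \<le> p"
  shows "\<exists>K>0. \<forall>v \<in> borel_measurable (lebesgue_on \<Omega>). \<forall>e>0.
    phi_norm \<Omega> (phi_pow \<phi> p) v < ennreal e \<longrightarrow> phi_norm \<Omega> \<phi> v \<le> ennreal (K * e)"
proof -
  obtain m where m: "emeasure (lebesgue_on \<Omega>) (space (lebesgue_on \<Omega>)) = ennreal m" "0 \<le> m"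
    using emeasure_dom by (cases "emeasure (lebesgue_on \<Omega>) (space (lebesgue_on \<Omega>))") auto
  define c where "c = 1 + (p - 1) * m"
  have c: "1 \<le> c" using p m by (simp add: c_def)
  have Lc: "0 < L * c" using c L_ge_1 by simp
  have "phi_norm \<Omega> \<phi> v \<le> ennreal (L * c * e)"
    if v [measurable]: "v \<in> borel_measurable (lebesgue_on \<Omega>)"
      and e: "0 < e" "phi_norm \<Omega> (phi_pow \<phi> p) v < ennreal e" for v e
  proof -
    obtain lam where lam: "0 < lam" "ennreal lam < ennreal e"
      "modular \<Omega> (phi_pow \<phi> p) (\<lambda>x. v x /\<^sub>R lam) \<le> 1"
      using e(2) by (rule phi_norm_lessE)
    have vl: "(\<lambda>x. v x /\<^sub>R lam) \<in> borel_measurable (lebesgue_on \<Omega>)" by measurable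
    have "modular \<Omega> \<phi> (\<lambda>x. v x /\<^sub>R lam) \<le> 1 + ennreal (p - 1) * ennreal m"
      using modular_le_modular_pow[OF p vl] lam(3) unfolding m(1)
      by (meson add_right_mono order_trans)
    also have "\<dots> = ennreal c"
      using p m(2) by (simp add: c_def ennreal_mult)
    finally have "modular \<Omega> \<phi> (\<lambda>x. (v x /\<^sub>R lam) /\<^sub>R (L * c)) \<le> 1"
      by (rule modular_scaled_le_1[OF vl c])
    then have "modular \<Omega> \<phi> (\<lambda>x. v x /\<^sub>R (L * c * lam)) \<le> 1"
      by (simp add: mult_ac)
    then have "phi_norm \<Omega> \<phi> v \<le> ennreal (L * c * lam)"
      using Lc lam(1) by (intro phi_norm_le) auto
    also have "\<dots> \<le> ennreal (L * c * e)"
      using Lc lam(1,2) by (intro ennreal_leI mult_left_mono) (auto simp: ennreal_less_iff)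
    finally show ?thesis .
  qed
  then show ?thesis using Lc by blast
qed

text \<open>The same test functions approximate in the weaker norm. This is what makes functions of
  finite \<open>E_p\<close> admissible for the relaxed functional.\<close>

lemma L1phi0_pow_imp:
  assumes p: "1 \<le> p" and u: "L1phi0 \<Omega> (phi_pow \<phi> p) u"
  shows "L1phi0 \<Omega> \<phi> u"
proof -
  obtain K where K: "0 < K" "\<And>v e. v \<in> borel_measurable (lebesgue_on \<Omega>) \<Longrightarrow> 0 < e \<Longrightarrow>
    phi_norm \<Omega> (phi_pow \<phi> p) v < ennreal e \<Longrightarrow> phi_norm \<Omega> \<phi> v \<le> ennreal (K * e)"
    using phi_norm_le_phi_norm_pow[OF p] by blast
  obtain \<xi> where xi: "\<And>i. test_fun \<Omega> (\<xi> i)"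
    "(\<lambda>i. L1phi_norm \<Omega> (phi_pow \<phi> p) (\<lambda>x. \<xi> i x - u x)) \<longlonglongrightarrow> 0"
    using u by (auto simp: L1phi0_def)
  have "(\<lambda>i. L1phi_norm \<Omega> \<phi> (\<lambda>x. \<xi> i x - u x)) \<longlonglongrightarrow> 0"
    unfolding ennreal_tendsto_0_iff
  proof (intro allI impI)
    fix e :: real assume e: "0 < e"
    \<comment> \<open>Chosen so that the \<open>L1\<close> part and the rescaled gradient part
      together amount to \<open>(1 + K) * e' = e / 2\<close>.\<close>
    define e' where "e' = e / (2 * (1 + K))"
    have e': "0 < e'" "e' + K * e' < e"
    proof -
      have "e' * (1 + K) = e / 2" using K(1) by (simp add: e'_def field_simps)
      then show "e' + K * e' < e" using e by (simp add: algebra_simps)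
      show "0 < e'" using e K(1) by (simp add: e'_def)
    qed
    have "\<forall>\<^sub>F i in sequentially. L1phi_norm \<Omega> (phi_pow \<phi> p) (\<lambda>x. \<xi> i x - u x) < ennreal e'"
      using xi(2) e'(1) unfolding ennreal_tendsto_0_iff by blast
    then show "\<forall>\<^sub>F i in sequentially. L1phi_norm \<Omega> \<phi> (\<lambda>x. \<xi> i x - u x) < ennreal e"
    proof eventually_elim
      case (elim i)
      let ?w = "\<lambda>x. \<xi> i x - u x"
      have W: "W11 \<Omega> ?w" using elim by (auto simp: L1phi_norm_def split: if_splits)
      then have s: "L1_norm \<Omega> ?w + phi_norm \<Omega> (phi_pow \<phi> p) (wgrad \<Omega> ?w) < ennreal e'"
        using elim by (simp add: L1phi_norm_def)
      have "L1_norm \<Omega> ?w \<le> ennreal e'" "phi_norm \<Omega> (phi_pow \<phi> p) (wgrad \<Omega> ?w) < ennreal e'"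
        using s by (meson le_iff_add order_less_imp_le order_le_less_trans, meson add_increasing order_refl order_le_less_trans zero_le)
      then have "L1phi_norm \<Omega> \<phi> ?w \<le> ennreal e' + ennreal (K * e')"
        using K(2)[OF wgrad_measurable[OF W] e'(1)] W by (simp add: L1phi_norm_def add_mono)
      also have "\<dots> < ennreal e"
        using e' e K(1) by (simp add: ennreal_plus[symmetric] ennreal_less_iff del: ennreal_plus)
      finally show ?case .
    qed
  qed
  then show ?thesis
    using u xi(1) L1phi_pow_imp[OF p] by (auto simp: L1phi0_def)
qed

subsection \<open>Boundary values\<close>

lemma wgrad_add:
  assumes "W11 \<Omega> u" "W11 \<Omega> v"
  shows "W11 \<Omega> (\<lambda>x. u x + v x)"
    and "AE x in lebesgue_on \<Omega>. wgrad \<Omega> (\<lambda>x. u x + v x) x = wgrad \<Omega> u x + wgrad \<Omega> v x"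
proof -
  have *: "weak_grad \<Omega> (\<lambda>x. u x + v x) (\<lambda>x. wgrad \<Omega> u x + wgrad \<Omega> v x)"
    by (intro weak_grad_add open_dom weak_grad_wgrad assms)
  then show "W11 \<Omega> (\<lambda>x. u x + v x)" by (auto simp: W11_def)
  show "AE x in lebesgue_on \<Omega>. wgrad \<Omega> (\<lambda>x. u x + v x) x = wgrad \<Omega> u x + wgrad \<Omega> v x"
    by (rule AE_wgrad_eq[OF open_dom *])
qed

lemma L1phi_norm_lessD:
  assumes "L1phi_norm \<Omega> \<phi> w < ennreal \<eta>"
  shows "W11 \<Omega> w" "phi_norm \<Omega> \<phi> (wgrad \<Omega> w) < ennreal \<eta>" "L1_norm \<Omega> w < ennreal \<eta>"
proof -
  show W: "W11 \<Omega> w" using assms by (auto simp: L1phi_norm_def split: if_splits)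
  then have s: "L1_norm \<Omega> w + phi_norm \<Omega> \<phi> (wgrad \<Omega> w) < ennreal \<eta>"
    using assms by (simp add: L1phi_norm_def)
  show "phi_norm \<Omega> \<phi> (wgrad \<Omega> w) < ennreal \<eta>"
    by (rule le_less_trans[OF _ s]) (simp add: add_increasing)
  show "L1_norm \<Omega> w < ennreal \<eta>"
    by (rule le_less_trans[OF _ s]) (simp add: add_increasing2)
qed

text \<open>Upper semicontinuity of the energy under norm convergence, obtained by writing
  \<open>v = y + (v - y)\<close>. It is the step from a competitor to its regular replacement in
  both recovery constructions.\<close>

lemma modular_wgrad_perturb:
  assumes y: "L1phi \<Omega> \<phi> y" and "0 < \<epsilon>"
  shows "\<exists>\<eta>>0. \<forall>v. L1phi_norm \<Omega> \<phi> (\<lambda>x. v x - y x) < ennreal \<eta> \<longrightarrow>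
    W11 \<Omega> v \<and> modular \<Omega> \<phi> (wgrad \<Omega> v) \<le> modular \<Omega> \<phi> (wgrad \<Omega> y) + ennreal \<epsilon>"
proof -
  have y': "W11 \<Omega> y" "modular \<Omega> \<phi> (wgrad \<Omega> y) < top"
    using y by (auto simp: L1phi_iff)
  obtain \<eta> where eta: "0 < \<eta>" "\<And>w. w \<in> borel_measurable (lebesgue_on \<Omega>) \<Longrightarrow> phi_norm \<Omega> \<phi> w < ennreal \<eta> \<Longrightarrow>
    modular \<Omega> \<phi> (\<lambda>x. wgrad \<Omega> y x + w x) \<le> modular \<Omega> \<phi> (wgrad \<Omega> y) + ennreal \<epsilon>"
    using modular_perturb[OF wgrad_measurable[OF y'(1)] y'(2) assms(2)] by blast
  have "W11 \<Omega> v \<and> modular \<Omega> \<phi> (wgrad \<Omega> v) \<le> modular \<Omega> \<phi> (wgrad \<Omega> y) + ennreal \<epsilon>"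
    if v: "L1phi_norm \<Omega> \<phi> (\<lambda>x. v x - y x) < ennreal \<eta>" for v
  proof -
    note w = L1phi_norm_lessD[OF v]
    have "W11 \<Omega> (\<lambda>x. y x + (v x - y x))"
      and ae: "AE x in lebesgue_on \<Omega>. wgrad \<Omega> (\<lambda>x. y x + (v x - y x)) x =
        wgrad \<Omega> y x + wgrad \<Omega> (\<lambda>x. v x - y x) x"
      by (rule wgrad_add[OF y'(1) w(1)])+
    moreover have "(\<lambda>x. y x + (v x - y x)) = v" by simp
    ultimately show ?thesis
      using eta(2)[OF wgrad_measurable[OF w(1)] w(2)] modular_cong_AE[OF ae] by simp
  qed
  then show ?thesis using eta(1) by blast
qed

lemma tendsto_pow_excess:
  assumes "ps \<longlonglongrightarrow> 1" "\<And>i. 1 < ps i" "1 < r" "M < top" "0 < \<epsilon>"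
  shows "\<forall>\<^sub>F i in sequentially. ennreal ((ps i - 1) / (r - 1)) * M < ennreal \<epsilon>"
proof -
  have "(\<lambda>i. (ps i - 1) / (r - 1)) \<longlonglongrightarrow> (1 - 1) / (r - 1)"
    using assms(3) by (intro tendsto_intros assms(1)) auto
  then have "(\<lambda>i. ennreal ((ps i - 1) / (r - 1)) * M) \<longlonglongrightarrow> 0"
    using assms(2,3) by (intro ennreal_tendsto_mult_0 assms(4)) (auto simp: less_imp_le)
  then show ?thesis using assms(5) unfolding ennreal_tendsto_0_iff by blast
qed

lemma E_p_eq: "L1phi0 \<Omega> (phi_pow \<phi> p) (\<lambda>x. u x - u0 x) \<Longrightarrow>
    E_p \<Omega> \<phi> u0 p u = modular \<Omega> (phi_pow \<phi> p) (wgrad \<Omega> u)"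
  by (simp add: E_p_def modular_def phi_pow_def)

lemma E_lim_lower:
  assumes ps: "\<And>i. 1 < ps i" "ps \<longlonglongrightarrow> 1"
    and us: "\<And>i. L1 \<Omega> (us i)" "(\<lambda>i. L1_norm \<Omega> (\<lambda>x. us i x - u x)) \<longlonglongrightarrow> 0"
    and u0: "W11 \<Omega> u0"
  shows "E_lim \<Omega> \<phi> u0 u \<le> liminf (\<lambda>i. E_p \<Omega> \<phi> u0 (ps i) (us i))"
proof (cases "liminf (\<lambda>i. E_p \<Omega> \<phi> u0 (ps i) (us i)) < top")
  case True
  let ?m = "emeasure (lebesgue_on \<Omega>) (space (lebesgue_on \<Omega>))"
  let ?C = "liminf (\<lambda>i. E_p \<Omega> \<phi> u0 (ps i) (us i))"
  obtain k where k: "strict_mono k" "(\<lambda>i. E_p \<Omega> \<phi> u0 (ps (k i)) (us (k i))) \<longlonglongrightarrow> ?C"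
    "\<And>i. E_p \<Omega> \<phi> u0 (ps (k i)) (us (k i)) < top"
    using ennreal_liminf_subseq[OF True] by blast
  \<comment> \<open>Every value along the subsequence is finite, so each term falls into the first
    branch of \<open>E_p\<close> and satisfies the boundary condition.\<close>
  have P: "L1phi0 \<Omega> (phi_pow \<phi> (ps (k i))) (\<lambda>x. us (k i) x - u0 x)" for i
    using k(3)[of i] by (auto simp: E_p_def split: if_splits)
  have P': "L1phi0 \<Omega> \<phi> (\<lambda>x. us (k i) x - u0 x)" for i
    using L1phi0_pow_imp[OF _ P[of i]] ps(1)[of "k i"] by simp
  have W: "W11 \<Omega> (us (k i))" for i
  proof -
    have "W11 \<Omega> (\<lambda>x. us (k i) x - u0 x)"
      using P'[of i] by (auto simp: L1phi0_def L1phi_def)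
    from wgrad_add(1)[OF this u0] show ?thesis by simp
  qed
  have "(\<lambda>i. L1_norm \<Omega> (\<lambda>x. us (k i) x - u x)) \<longlonglongrightarrow> 0"
    using LIMSEQ_subseq_LIMSEQ[OF us(2) k(1)] by (simp add: o_def)
  then have "E_lim \<Omega> \<phi> u0 u \<le> liminf (\<lambda>i. modular \<Omega> \<phi> (wgrad \<Omega> (us (k i))))"
    unfolding E_lim_def modular_def using P' us(1)
    by (intro Inf_lower CollectI exI[of _ "\<lambda>i. us (k i)"]) auto
  also have "\<dots> \<le> liminf (\<lambda>i. E_p \<Omega> \<phi> u0 (ps (k i)) (us (k i)) + ennreal (ps (k i) - 1) * ?m)"
  proof (rule Liminf_mono, rule always_eventually, rule allI)
    fix i
    show "modular \<Omega> \<phi> (wgrad \<Omega> (us (k i))) \<le> E_p \<Omega> \<phi> u0 (ps (k i)) (us (k i)) + ennreal (ps (k i) - 1) * ?m"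
      unfolding E_p_eq[OF P]
      by (rule modular_le_modular_pow[OF _ wgrad_measurable[OF W]]) (use ps(1)[of "k i"] in simp)
  qed
  also have "\<dots> = ?C"
  proof -
    have "(\<lambda>i. ps (k i) - 1) \<longlonglongrightarrow> 1 - 1"
      using LIMSEQ_subseq_LIMSEQ[OF ps(2) k(1)] by (intro tendsto_intros) (simp add: o_def)
    then have "(\<lambda>i. ennreal (ps (k i) - 1) * ?m) \<longlonglongrightarrow> 0"
      using ps(1) emeasure_dom by (intro ennreal_tendsto_mult_0) (auto simp: less_imp_le)
    from tendsto_add[OF k(2) this] show ?thesis
      by (intro lim_imp_Liminf) simp_all
  qed
  finally show ?thesis .
qed (simp add: less_top[symmetric])

lemma E_lim_recovery:
  assumes ps: "\<And>i. 1 < ps i" "\<And>i. ps i < r" "ps \<longlonglongrightarrow> 1" and r: "1 < r"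
    and u0: "L1phi \<Omega> (phi_pow \<phi> r) u0" and u: "L1 \<Omega> u" and fin: "E_lim \<Omega> \<phi> u0 u < top" and eps: "0 < \<epsilon>"
  shows "\<exists>v. L1 \<Omega> v \<and> L1_norm \<Omega> (\<lambda>x. v x - u x) < ennreal \<epsilon> \<and>
    (\<forall>\<^sub>F i in sequentially. E_p \<Omega> \<phi> u0 (ps i) v \<le> E_lim \<Omega> \<phi> u0 u + ennreal \<epsilon>)"
proof -
  interpret R: doubling_phi \<Omega> "phi_pow \<phi> r" L "q * r" \<beta>
    using r by (intro doubling_phi_pow) simp
  \<comment> \<open>Three errors arise: near-optimality of the competitor, its replacement by
    \<open>v\<close>, and the excess of the \<open>\<phi>^p\<close>-energy over the
    \<open>\<phi>\<close>-energy.\<close>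
  define e where "e = \<epsilon> / 3"
  have e: "0 < e" using eps by (simp add: e_def)
  have u0': "W11 \<Omega> u0" "modular \<Omega> (phi_pow \<phi> r) (wgrad \<Omega> u0) < top"
    using u0 by (auto simp: R.L1phi_iff)
  obtain us where us: "\<And>i. L1phi0 \<Omega> \<phi> (\<lambda>x. us i x - u0 x)" "\<And>i. L1 \<Omega> (us i)"
    "(\<lambda>i. L1_norm \<Omega> (\<lambda>x. us i x - u x)) \<longlonglongrightarrow> 0"
    "liminf (\<lambda>i. modular \<Omega> \<phi> (wgrad \<Omega> (us i))) < E_lim \<Omega> \<phi> u0 u + ennreal e"
    using ennreal_less_add[OF fin e] unfolding E_lim_def Inf_less_iff modular_def by auto
  have "\<forall>\<^sub>F i in sequentially. L1_norm \<Omega> (\<lambda>x. us i x - u x) < ennreal e"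
    using us(3) e unfolding ennreal_tendsto_0_iff by blast
  then obtain i where i: "modular \<Omega> \<phi> (wgrad \<Omega> (us i)) < E_lim \<Omega> \<phi> u0 u + ennreal e"
    "L1_norm \<Omega> (\<lambda>x. us i x - u x) < ennreal e"
    using liminf_less_frequently[OF us(4)] by blast
  define y where "y = us i"
  have "W11 \<Omega> (\<lambda>x. y x - u0 x)"
    using us(1)[of i] by (auto simp: L1phi0_def L1phi_def y_def)
  from wgrad_add(1)[OF this u0'(1)] have Wy: "W11 \<Omega> y" by simp
  have V: "modular \<Omega> \<phi> (wgrad \<Omega> y) < E_lim \<Omega> \<phi> u0 u + ennreal e"
    using i(1) by (simp add: y_def)
  have "L1phi \<Omega> \<phi> y"
    using Wy order_less_trans[OF V] fin by (simp add: L1phi_iff)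
  then obtain \<eta> where eta: "0 < \<eta>" "\<And>v. L1phi_norm \<Omega> \<phi> (\<lambda>x. v x - y x) < ennreal \<eta> \<Longrightarrow>
    W11 \<Omega> v \<and> modular \<Omega> \<phi> (wgrad \<Omega> v) \<le> modular \<Omega> \<phi> (wgrad \<Omega> y) + ennreal e"
    using modular_wgrad_perturb[OF _ e] by blast
  obtain \<xi>s where xis: "\<And>i. test_fun \<Omega> (\<xi>s i)"
    "(\<lambda>j. L1phi_norm \<Omega> \<phi> (\<lambda>x. \<xi>s j x - (y x - u0 x))) \<longlonglongrightarrow> 0"
    using us(1)[of i] by (auto simp: L1phi0_def y_def)
  have "\<forall>\<^sub>F j in sequentially. L1phi_norm \<Omega> \<phi> (\<lambda>x. \<xi>s j x - (y x - u0 x)) < ennreal (min \<eta> e)"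
    using xis(2) e eta(1) unfolding ennreal_tendsto_0_iff by simp
  then obtain j where j: "L1phi_norm \<Omega> \<phi> (\<lambda>x. \<xi>s j x - (y x - u0 x)) < ennreal (min \<eta> e)"
    using eventually_happens'[OF sequentially_bot] by blast
  define \<xi> where "\<xi> = \<xi>s j"
  have xi: "test_fun \<Omega> \<xi>" by (simp add: \<xi>_def xis(1))
  \<comment> \<open>The boundary part \<open>y - u0\<close> of the competitor is exchanged for a
    test function; the difference \<open>v - u0\<close> is then admissible for all powers of
    \<open>\<phi>\<close> simultaneously.\<close>
  define v where "v x = u0 x + \<xi> x" for x
  \<comment> \<open>Here \<open>\<eta>\<close> controls the energy of \<open>v\<close> and
    \<open>e\<close> its \<open>L1\<close> distance from \<open>y\<close>.\<close>
  have vy: "L1phi_norm \<Omega> \<phi> (\<lambda>x. v x - y x) < ennreal (min \<eta> e)"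
    using j by (simp add: v_def \<xi>_def algebra_simps)
  have "L1phi_norm \<Omega> \<phi> (\<lambda>x. v x - y x) < ennreal \<eta>"
    by (rule less_le_trans[OF vy]) (simp add: ennreal_leI)
  from eta(2)[OF this] have v: "W11 \<Omega> v"
    "modular \<Omega> \<phi> (wgrad \<Omega> v) \<le> modular \<Omega> \<phi> (wgrad \<Omega> y) + ennreal e" by auto
  have Lv: "L1 \<Omega> v" by (rule W11_imp_L1[OF v(1)])
  have Ly: "L1 \<Omega> y" by (rule W11_imp_L1[OF Wy])
  have "L1_norm \<Omega> (\<lambda>x. v x - u x) = L1_norm \<Omega> (\<lambda>x. (v x - y x) + (y x - u x))" by simp
  also have "\<dots> \<le> L1_norm \<Omega> (\<lambda>x. v x - y x) + L1_norm \<Omega> (\<lambda>x. y x - u x)"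
    by (intro L1_norm_add_le L1_diff Lv Ly u)
  also have "\<dots> \<le> ennreal e + ennreal e"
  proof (rule add_mono)
    have "L1phi_norm \<Omega> \<phi> (\<lambda>x. v x - y x) < ennreal e"
      by (rule less_le_trans[OF vy]) (simp add: ennreal_leI)
    from L1phi_norm_lessD(3)[OF this] show "L1_norm \<Omega> (\<lambda>x. v x - y x) \<le> ennreal e" by simp
    show "L1_norm \<Omega> (\<lambda>x. y x - u x) \<le> ennreal e" using i(2) by (simp add: y_def)
  qed
  also have "\<dots> < ennreal \<epsilon>"
    using eps by (simp add: e_def ennreal_plus[symmetric] ennreal_less_iff del: ennreal_plus)
  finally have close: "L1_norm \<Omega> (\<lambda>x. v x - u x) < ennreal \<epsilon>" .
  have Wxi: "W11 \<Omega> \<xi>" and mxi: "modular \<Omega> (phi_pow \<phi> r) (wgrad \<Omega> \<xi>) < top"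
    using R.L1phi_smooth[OF test_fun_smooth[OF xi] refl] by (auto simp: R.L1phi_iff)
  have "AE x in lebesgue_on \<Omega>. wgrad \<Omega> v x = wgrad \<Omega> u0 x + wgrad \<Omega> \<xi> x"
    using wgrad_add(2)[OF u0'(1) Wxi] by (simp add: v_def[abs_def])
  then have "modular \<Omega> (phi_pow \<phi> r) (wgrad \<Omega> v) =
      modular \<Omega> (phi_pow \<phi> r) (\<lambda>x. wgrad \<Omega> u0 x + wgrad \<Omega> \<xi> x)"
    by (rule R.modular_cong_AE)
  \<comment> \<open>Only finiteness matters here, so \<open>\<delta> = 1\<close> is good enough. The
    summands are finite by the assumption on \<open>u0\<close> and by smoothness of the test
    function.\<close>
  also have "\<dots> \<le> ennreal ((1 + 1) powr (q * r)) * modular \<Omega> (phi_pow \<phi> r) (wgrad \<Omega> u0) +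
      ennreal ((1 + 1 / 1) powr (q * r)) * modular \<Omega> (phi_pow \<phi> r) (wgrad \<Omega> \<xi>)"
    by (intro R.modular_add_le wgrad_measurable u0'(1) Wxi) simp
  also have "\<dots> < top"
    using u0'(2) mxi by (simp add: ennreal_mult_less_top)
  finally have Mr: "modular \<Omega> (phi_pow \<phi> r) (wgrad \<Omega> v) < top" .
  have "\<forall>\<^sub>F i in sequentially. E_p \<Omega> \<phi> u0 (ps i) v \<le> E_lim \<Omega> \<phi> u0 u + ennreal \<epsilon>"
    using tendsto_pow_excess[OF ps(3,1) r Mr e]
  proof eventually_elim
    case (elim i)
    interpret P: doubling_phi \<Omega> "phi_pow \<phi> (ps i)" L "q * ps i" \<beta>
      using ps(1)[of i] by (intro doubling_phi_pow) simp
    have "L1phi0 \<Omega> (phi_pow \<phi> (ps i)) (\<lambda>x. v x - u0 x)"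
      using P.L1phi0_test_fun[OF xi] by (simp add: v_def)
    then have "E_p \<Omega> \<phi> u0 (ps i) v = modular \<Omega> (phi_pow \<phi> (ps i)) (wgrad \<Omega> v)"
      by (rule E_p_eq)
    also have "\<dots> \<le> modular \<Omega> \<phi> (wgrad \<Omega> v) +
        ennreal ((ps i - 1) / (r - 1)) * modular \<Omega> (phi_pow \<phi> r) (wgrad \<Omega> v)"
      by (rule modular_pow_interpolate[OF ps(1,2) wgrad_measurable[OF v(1)]])
    also have "\<dots> \<le> ((E_lim \<Omega> \<phi> u0 u + ennreal e) + ennreal e) + ennreal e"
      using elim V by (intro add_mono order_trans[OF v(2)]) auto
    also have "\<dots> = E_lim \<Omega> \<phi> u0 u + ennreal \<epsilon>"
      using e by (simp add: add.assoc ennreal_plus[symmetric] e_def del: ennreal_plus)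
    finally show ?case .
  qed
  then show ?thesis using Lv close by blast
qed

lemma Gamma_conv_E:
  assumes r: "1 < r" and u0: "L1phi \<Omega> (phi_pow \<phi> r) u0"
  shows "Gamma_conv {1<..<r} (L1 \<Omega>) (\<lambda>us u. (\<lambda>i. L1_norm \<Omega> (\<lambda>x. us i x - u x)) \<longlonglongrightarrow> 0)
          (E_p \<Omega> \<phi> u0) (E_lim \<Omega> \<phi> u0)"
  unfolding Gamma_conv_def
proof (intro allI impI conjI)
  fix ps u us
  assume "(\<forall>i. ps i \<in> {1<..<r}) \<and> ps \<longlonglongrightarrow> 1"
    "L1 \<Omega> u \<and> (\<forall>i. L1 \<Omega> (us i)) \<and> (\<lambda>i. L1_norm \<Omega> (\<lambda>x. us i x - u x)) \<longlonglongrightarrow> 0"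
  then show "E_lim \<Omega> \<phi> u0 u \<le> liminf (\<lambda>i. E_p \<Omega> \<phi> u0 (ps i) (us i))"
    using u0 by (intro E_lim_lower) (auto simp: L1phi_def)
next
  fix ps u
  assume ps: "(\<forall>i. ps i \<in> {1<..<r}) \<and> ps \<longlonglongrightarrow> 1" and u: "L1 \<Omega> u"
  show "\<exists>us. (\<forall>i. L1 \<Omega> (us i)) \<and> (\<lambda>i. L1_norm \<Omega> (\<lambda>x. us i x - u x)) \<longlonglongrightarrow> 0 \<and>
    limsup (\<lambda>i. E_p \<Omega> \<phi> u0 (ps i) (us i)) \<le> E_lim \<Omega> \<phi> u0 u"
  proof (cases "E_lim \<Omega> \<phi> u0 u < top")
    case True
    then show ?thesis
      using ps by (intro recovery_sequence E_lim_recovery[OF _ _ _ r u0 u]) auto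
  next
    case False
    then show ?thesis
      using u by (intro exI[of _ "\<lambda>_. u"]) (auto simp: L1_norm_def less_top[symmetric])
  qed
qed

subsection \<open>Fidelity term\<close>

lemma fidelity_split:
  assumes "1 \<le> p" "W11 \<Omega> u" "L2 \<Omega> f"
  shows "(\<integral>\<^sup>+x. ennpow (\<phi> x (norm (wgrad \<Omega> u x))) p + ennreal ((u x - f x)\<^sup>2) \<partial>lebesgue_on \<Omega>) =
    modular \<Omega> (phi_pow \<phi> p) (wgrad \<Omega> u) + (\<integral>\<^sup>+x. ennreal ((u x - f x)\<^sup>2) \<partial>lebesgue_on \<Omega>)"
proof -
  have m: "(\<lambda>x. \<phi> x (norm (wgrad \<Omega> u x))) \<in> borel_measurable (lebesgue_on \<Omega>)"
    "u \<in> borel_measurable (lebesgue_on \<Omega>)" "f \<in> borel_measurable (lebesgue_on \<Omega>)"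
    using assms phi_norm_measurable[OF wgrad_measurable] W11_imp_L1 by (auto simp: L1_def L2_def)
  note [measurable] = m
  show ?thesis
    unfolding modular_def phi_pow_def by (rule nn_integral_add) measurable
qed

lemma F_p_eq:
  assumes "1 \<le> p" "L1phi \<Omega> (phi_pow \<phi> p) u" "L2 \<Omega> u" "L2 \<Omega> f"
  shows "F_p \<Omega> \<phi> f p u = modular \<Omega> (phi_pow \<phi> p) (wgrad \<Omega> u) +
    (\<integral>\<^sup>+x. ennreal ((u x - f x)\<^sup>2) \<partial>lebesgue_on \<Omega>)"
  using fidelity_split[OF assms(1) _ assms(4), of u] assms
  by (simp add: F_p_def L1phi_def)

lemma fidelity_split_1:
  assumes "W11 \<Omega> u" "L2 \<Omega> f"
  shows "(\<integral>\<^sup>+x. \<phi> x (norm (wgrad \<Omega> u x)) + ennreal ((u x - f x)\<^sup>2) \<partial>lebesgue_on \<Omega>) =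
    modular \<Omega> \<phi> (wgrad \<Omega> u) + (\<integral>\<^sup>+x. ennreal ((u x - f x)\<^sup>2) \<partial>lebesgue_on \<Omega>)"
  using fidelity_split[OF order_refl assms] by (simp add: ennpow_1 phi_pow_def)

text \<open>Membership in the energy class involves no approximation by test functions here, so
  finiteness of the energy replaces the comparison of norms. The fidelity term is common to both
  sides and produces no error.\<close>

lemma F_lim_lower:
  assumes ps: "\<And>i. 1 < ps i" "ps \<longlonglongrightarrow> 1" and f: "L2 \<Omega> f"
    and us: "(\<lambda>i. L2_norm \<Omega> (\<lambda>x. us i x - u x)) \<longlonglongrightarrow> 0"
  shows "F_lim \<Omega> \<phi> f u \<le> liminf (\<lambda>i. F_p \<Omega> \<phi> f (ps i) (us i))"
proof (cases "liminf (\<lambda>i. F_p \<Omega> \<phi> f (ps i) (us i)) < top")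
  case True
  let ?m = "emeasure (lebesgue_on \<Omega>) (space (lebesgue_on \<Omega>))"
  let ?C = "liminf (\<lambda>i. F_p \<Omega> \<phi> f (ps i) (us i))"
  obtain k where k: "strict_mono k" "(\<lambda>i. F_p \<Omega> \<phi> f (ps (k i)) (us (k i))) \<longlonglongrightarrow> ?C"
    "\<And>i. F_p \<Omega> \<phi> f (ps (k i)) (us (k i)) < top"
    using ennreal_liminf_subseq[OF True] by blast
  have P: "L1phi \<Omega> (phi_pow \<phi> (ps (k i))) (us (k i))" "L2 \<Omega> (us (k i))" for i
    using k(3)[of i] by (auto simp: F_p_def split: if_splits)
  have p: "1 \<le> ps (k i)" for i using ps(1)[of "k i"] by simp
  have P': "L1phi \<Omega> \<phi> (us (k i))" for i
    by (rule L1phi_pow_imp[OF p P(1)])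
  have W: "W11 \<Omega> (us (k i))" for i using P'[of i] by (simp add: L1phi_def)
  have "(\<lambda>i. L2_norm \<Omega> (\<lambda>x. us (k i) x - u x)) \<longlonglongrightarrow> 0"
    using LIMSEQ_subseq_LIMSEQ[OF us k(1)] by (simp add: o_def)
  then have "F_lim \<Omega> \<phi> f u \<le> liminf (\<lambda>i. \<integral>\<^sup>+x. \<phi> x (norm (wgrad \<Omega> (us (k i)) x)) +
      ennreal ((us (k i) x - f x)\<^sup>2) \<partial>lebesgue_on \<Omega>)"
    unfolding F_lim_def using P' P(2)
    by (intro Inf_lower CollectI exI[of _ "\<lambda>i. us (k i)"]) auto
  also have "\<dots> \<le> liminf (\<lambda>i. F_p \<Omega> \<phi> f (ps (k i)) (us (k i)) + ennreal (ps (k i) - 1) * ?m)"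
  proof (rule Liminf_mono, rule always_eventually, rule allI)
    fix i
    let ?I = "\<integral>\<^sup>+x. ennreal ((us (k i) x - f x)\<^sup>2) \<partial>lebesgue_on \<Omega>"
    have "modular \<Omega> \<phi> (wgrad \<Omega> (us (k i))) + ?I \<le>
      (modular \<Omega> (phi_pow \<phi> (ps (k i))) (wgrad \<Omega> (us (k i))) + ennreal (ps (k i) - 1) * ?m) + ?I"
      by (intro add_right_mono modular_le_modular_pow[OF p wgrad_measurable[OF W]])
    then show "(\<integral>\<^sup>+x. \<phi> x (norm (wgrad \<Omega> (us (k i)) x)) + ennreal ((us (k i) x - f x)\<^sup>2) \<partial>lebesgue_on \<Omega>)
        \<le> F_p \<Omega> \<phi> f (ps (k i)) (us (k i)) + ennreal (ps (k i) - 1) * ?m"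
      unfolding F_p_eq[OF p P f] fidelity_split_1[OF W f] by (simp only: ac_simps)
  qed
  also have "\<dots> = ?C"
  proof -
    have "(\<lambda>i. ps (k i) - 1) \<longlonglongrightarrow> 1 - 1"
      using LIMSEQ_subseq_LIMSEQ[OF ps(2) k(1)] by (intro tendsto_intros) (simp add: o_def)
    then have "(\<lambda>i. ennreal (ps (k i) - 1) * ?m) \<longlonglongrightarrow> 0"
      using ps(1) emeasure_dom by (intro ennreal_tendsto_mult_0) (auto simp: less_imp_le)
    from tendsto_add[OF k(2) this] show ?thesis
      by (intro lim_imp_Liminf) simp_all
  qed
  finally show ?thesis .
qed (simp add: less_top[symmetric])

lemma F_lim_recovery:
  assumes ps: "\<And>i. 1 < ps i" "ps \<longlonglongrightarrow> 1"
    and f: "L2 \<Omega> f" and u: "L2 \<Omega> u" and fin: "F_lim \<Omega> \<phi> f u < top" and eps: "0 < \<epsilon>"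
    and dense: "\<And>u \<epsilon>. L1phi \<Omega> \<phi> u \<Longrightarrow> L2 \<Omega> u \<Longrightarrow> 0 < \<epsilon> \<Longrightarrow> \<exists>v. smooth_closure \<Omega> v \<and>
      L1phi_norm \<Omega> \<phi> (\<lambda>x. v x - u x) + L2_norm \<Omega> (\<lambda>x. v x - u x) < ennreal \<epsilon>"
  shows "\<exists>v. L2 \<Omega> v \<and> L2_norm \<Omega> (\<lambda>x. v x - u x) < ennreal \<epsilon> \<and>
    (\<forall>\<^sub>F i in sequentially. F_p \<Omega> \<phi> f (ps i) v \<le> F_lim \<Omega> \<phi> f u + ennreal \<epsilon>)"
proof -
  let ?I = "\<lambda>b. \<integral>\<^sup>+x. ennreal ((b x)\<^sup>2) \<partial>lebesgue_on \<Omega>"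
  \<comment> \<open>The exponent 2 plays the part of \<open>r\<close> in the interpolation. Any
    fixed exponent above 1 would do, since \<open>v\<close> will be smooth and \<open>ps i\<close>
    is eventually below it.\<close>
  interpret R: doubling_phi \<Omega> "phi_pow \<phi> 2" L "q * 2" \<beta>
    by (intro doubling_phi_pow) simp
  \<comment> \<open>Four errors arise: near-optimality of the competitor, the change of the gradient
    energy, the change of the fidelity term, and the excess of the
    \<open>\<phi>^p\<close>-energy.\<close>
  define e where "e = \<epsilon> / 4"
  have e: "0 < e" using eps by (simp add: e_def)
  obtain us where us: "\<And>i. L1phi \<Omega> \<phi> (us i)" "\<And>i. L2 \<Omega> (us i)"
    "(\<lambda>i. L2_norm \<Omega> (\<lambda>x. us i x - u x)) \<longlonglongrightarrow> 0"
    "liminf (\<lambda>i. \<integral>\<^sup>+x. \<phi> x (norm (wgrad \<Omega> (us i) x)) + ennreal ((us i x - f x)\<^sup>2) \<partial>lebesgue_on \<Omega>)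
      < F_lim \<Omega> \<phi> f u + ennreal e"
    using ennreal_less_add[OF fin e] unfolding F_lim_def Inf_less_iff by auto
  have "\<forall>\<^sub>F i in sequentially. L2_norm \<Omega> (\<lambda>x. us i x - u x) < ennreal e"
    using us(3) e unfolding ennreal_tendsto_0_iff by blast
  from liminf_less_frequently[OF us(4) this] obtain i where
    i: "(\<integral>\<^sup>+x. \<phi> x (norm (wgrad \<Omega> (us i) x)) + ennreal ((us i x - f x)\<^sup>2) \<partial>lebesgue_on \<Omega>)
      < F_lim \<Omega> \<phi> f u + ennreal e" "L2_norm \<Omega> (\<lambda>x. us i x - u x) < ennreal e"
    by blast
  define y where "y = us i"
  have y: "L1phi \<Omega> \<phi> y" "L2 \<Omega> y" "W11 \<Omega> y" "L2_norm \<Omega> (\<lambda>x. y x - u x) < ennreal e"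
    using us(1)[of i] us(2)[of i] i(2) by (auto simp: y_def L1phi_def)
  have V: "modular \<Omega> \<phi> (wgrad \<Omega> y) + ?I (\<lambda>x. y x - f x) < F_lim \<Omega> \<phi> f u + ennreal e"
    using i(1) fidelity_split_1[OF y(3) f] by (simp add: y_def)
  then have "modular \<Omega> \<phi> (wgrad \<Omega> y) + ?I (\<lambda>x. y x - f x) < top"
    using fin by (meson order_less_trans ennreal_add_less_top ennreal_less_top)
  then have fid: "?I (\<lambda>x. y x - f x) < top" by simp
  have meas: "f \<in> borel_measurable (lebesgue_on \<Omega>)" "u \<in> borel_measurable (lebesgue_on \<Omega>)"
    "y \<in> borel_measurable (lebesgue_on \<Omega>)"
    using f u y(2) by (auto simp: L2_def)
  obtain \<eta>1 where eta1: "0 < \<eta>1" "\<And>v. L1phi_norm \<Omega> \<phi> (\<lambda>x. v x - y x) < ennreal \<eta>1 \<Longrightarrow>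
    W11 \<Omega> v \<and> modular \<Omega> \<phi> (wgrad \<Omega> v) \<le> modular \<Omega> \<phi> (wgrad \<Omega> y) + ennreal e"
    using modular_wgrad_perturb[OF y(1) e] by blast
  have "(\<lambda>x. y x - f x) \<in> borel_measurable (lebesgue_on \<Omega>)"
    using meas by (intro borel_measurable_diff)
  from sq_integral_perturb[OF this fid e]
  obtain \<eta>2 where eta2: "0 < \<eta>2" "\<And>b. b \<in> borel_measurable (lebesgue_on \<Omega>) \<Longrightarrow> L2_norm \<Omega> b < ennreal \<eta>2 \<Longrightarrow>
    ?I (\<lambda>x. y x - f x + b x) \<le> ?I (\<lambda>x. y x - f x) + ennreal e"
    by blast
  \<comment> \<open>The three bounds control the \<open>L2\<close> distance, the gradient energy and
    the fidelity term, in this order.\<close>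
  define \<eta> where "\<eta> = min e (min \<eta>1 \<eta>2)"
  have "0 < \<eta>" using e eta1(1) eta2(1) by (simp add: \<eta>_def)
  from dense[OF y(1,2) this] obtain v where v: "smooth_closure \<Omega> v"
    "L1phi_norm \<Omega> \<phi> (\<lambda>x. v x - y x) + L2_norm \<Omega> (\<lambda>x. v x - y x) < ennreal \<eta>" by blast
  have le: "ennreal \<eta> \<le> ennreal e" "ennreal \<eta> \<le> ennreal \<eta>1" "ennreal \<eta> \<le> ennreal \<eta>2"
    by (auto simp: \<eta>_def intro!: ennreal_leI)
  have v1: "L1phi_norm \<Omega> \<phi> (\<lambda>x. v x - y x) < ennreal \<eta>"
    by (rule le_less_trans[OF _ v(2)]) (simp add: add_increasing2)
  have v2: "L2_norm \<Omega> (\<lambda>x. v x - y x) < ennreal \<eta>"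
    by (rule le_less_trans[OF _ v(2)]) (simp add: add_increasing)
  have vW: "W11 \<Omega> v"
    and vmod: "modular \<Omega> \<phi> (wgrad \<Omega> v) \<le> modular \<Omega> \<phi> (wgrad \<Omega> y) + ennreal e"
    using eta1(2)[OF less_le_trans[OF v1 le(2)]] by auto
  have vm: "v \<in> borel_measurable (lebesgue_on \<Omega>)"
    using W11_imp_L1[OF vW] by (simp add: L1_def)
  have vym: "(\<lambda>x. v x - y x) \<in> borel_measurable (lebesgue_on \<Omega>)"
    "(\<lambda>x. y x - u x) \<in> borel_measurable (lebesgue_on \<Omega>)"
    using vm meas by (intro borel_measurable_diff; simp)+
  have vfid: "?I (\<lambda>x. v x - f x) \<le> ?I (\<lambda>x. y x - f x) + ennreal e"
    using eta2(2)[OF vym(1) less_le_trans[OF v2 le(3)]] by simp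
  obtain w where w: "smooth w" "\<And>x. x \<in> \<Omega> \<Longrightarrow> v x = w x"
    using v(1) closure_subset[of \<Omega>] unfolding smooth_closure_def by blast
  have "L1 \<Omega> (\<lambda>x. (w x)\<^sup>2)"
    by (intro L1_continuous open_dom bounded_dom continuous_intros smooth_continuous_on w(1))
  then have "L1 \<Omega> (\<lambda>x. (v x)\<^sup>2)"
    by (subst L1_cong[of _ _ "\<lambda>x. (w x)\<^sup>2"]) (simp_all add: w(2))
  then have vL2: "L2 \<Omega> v" using vm by (simp add: L1_def L2_def)
  have close: "L2_norm \<Omega> (\<lambda>x. v x - u x) < ennreal \<epsilon>"
  proof -
    have "?I (\<lambda>x. v x - u x) = ?I (\<lambda>x. (v x - y x) + (y x - u x))" by simp
    \<comment> \<open>With \<open>\<delta> = 1\<close> the squared distance is at most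
      \<open>4 * e^2 = \<epsilon>^2 / 4\<close>.\<close>
    also have "\<dots> \<le> ennreal (1 + 1) * ?I (\<lambda>x. v x - y x) + ennreal (1 + 1 / 1) * ?I (\<lambda>x. y x - u x)"
      by (rule sq_integral_add_le[OF vym]) simp
    also have "\<dots> \<le> ennreal 2 * ennreal (e\<^sup>2) + ennreal 2 * ennreal (e\<^sup>2)"
      using less_le_trans[OF v2 le(1)] y(4) e
      by (intro add_mono mult_mono) (simp_all add: L2_norm_less_iff less_imp_le)
    also have "\<dots> < ennreal (\<epsilon>\<^sup>2)"
      using eps by (simp add: e_def ennreal_mult[symmetric] ennreal_plus[symmetric] ennreal_less_iff
          power2_eq_square del: ennreal_plus ennreal_numeral)
    finally show ?thesis using eps by (simp add: L2_norm_less_iff)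
  qed
  have M2: "modular \<Omega> (phi_pow \<phi> 2) (wgrad \<Omega> v) < top"
    by (rule R.modular_smooth_finite[OF w])
  have "\<forall>\<^sub>F i in sequentially. ps i < 2"
    using ps(2) by (rule order_tendstoD) simp
  moreover have "\<forall>\<^sub>F i in sequentially. ennreal ((ps i - 1) / (2 - 1)) * modular \<Omega> (phi_pow \<phi> 2) (wgrad \<Omega> v) < ennreal e"
    by (rule tendsto_pow_excess[OF ps(2,1) _ M2 e]) simp
  ultimately have "\<forall>\<^sub>F i in sequentially. F_p \<Omega> \<phi> f (ps i) v \<le> F_lim \<Omega> \<phi> f u + ennreal \<epsilon>"
  proof eventually_elim
    case (elim i)
    interpret P: doubling_phi \<Omega> "phi_pow \<phi> (ps i)" L "q * ps i" \<beta>
      using ps(1)[of i] by (intro doubling_phi_pow) simp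
    have "F_p \<Omega> \<phi> f (ps i) v = modular \<Omega> (phi_pow \<phi> (ps i)) (wgrad \<Omega> v) + ?I (\<lambda>x. v x - f x)"
      using ps(1)[of i] by (intro F_p_eq P.L1phi_smooth[OF w] vL2 f) auto
    also have "\<dots> \<le> (modular \<Omega> \<phi> (wgrad \<Omega> v) +
        ennreal ((ps i - 1) / (2 - 1)) * modular \<Omega> (phi_pow \<phi> 2) (wgrad \<Omega> v)) + ?I (\<lambda>x. v x - f x)"
      by (intro add_right_mono modular_pow_interpolate[OF ps(1) elim(1) wgrad_measurable[OF vW]])
    also have "\<dots> \<le> ((modular \<Omega> \<phi> (wgrad \<Omega> y) + ennreal e) + ennreal e) +
        (?I (\<lambda>x. y x - f x) + ennreal e)"
      using elim(2) by (intro add_mono vmod vfid) simp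
    also have "\<dots> = (modular \<Omega> \<phi> (wgrad \<Omega> y) + ?I (\<lambda>x. y x - f x)) + (ennreal e + ennreal e + ennreal e)"
      by (simp only: ac_simps)
    also have "\<dots> \<le> (F_lim \<Omega> \<phi> f u + ennreal e) + (ennreal e + ennreal e + ennreal e)"
      using V by (intro add_right_mono) simp
    also have "\<dots> = F_lim \<Omega> \<phi> f u + ennreal \<epsilon>"
      using e by (simp add: add.assoc ennreal_plus[symmetric] e_def del: ennreal_plus)
    finally show ?case .
  qed
  then show ?thesis using vL2 close by blast
qed

lemma Gamma_conv_F:
  assumes f: "L2 \<Omega> f"
    and dense: "\<And>u \<epsilon>. L1phi \<Omega> \<phi> u \<Longrightarrow> L2 \<Omega> u \<Longrightarrow> 0 < \<epsilon> \<Longrightarrow> \<exists>v. smooth_closure \<Omega> v \<and>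
      L1phi_norm \<Omega> \<phi> (\<lambda>x. v x - u x) + L2_norm \<Omega> (\<lambda>x. v x - u x) < ennreal \<epsilon>"
  shows "Gamma_conv {1<..} (L2 \<Omega>) (\<lambda>us u. (\<lambda>i. L2_norm \<Omega> (\<lambda>x. us i x - u x)) \<longlonglongrightarrow> 0)
          (F_p \<Omega> \<phi> f) (F_lim \<Omega> \<phi> f)"
  unfolding Gamma_conv_def
proof (intro allI impI conjI)
  fix ps :: "nat \<Rightarrow> real" and u us
  assume "(\<forall>i. ps i \<in> {1<..}) \<and> ps \<longlonglongrightarrow> 1"
    "L2 \<Omega> u \<and> (\<forall>i. L2 \<Omega> (us i)) \<and> (\<lambda>i. L2_norm \<Omega> (\<lambda>x. us i x - u x)) \<longlonglongrightarrow> 0"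
  then show "F_lim \<Omega> \<phi> f u \<le> liminf (\<lambda>i. F_p \<Omega> \<phi> f (ps i) (us i))"
    by (intro F_lim_lower f) auto
next
  fix ps :: "nat \<Rightarrow> real" and u
  assume ps: "(\<forall>i. ps i \<in> {1<..}) \<and> ps \<longlonglongrightarrow> 1" and u: "L2 \<Omega> u"
  show "\<exists>us. (\<forall>i. L2 \<Omega> (us i)) \<and> (\<lambda>i. L2_norm \<Omega> (\<lambda>x. us i x - u x)) \<longlonglongrightarrow> 0 \<and>
    limsup (\<lambda>i. F_p \<Omega> \<phi> f (ps i) (us i)) \<le> F_lim \<Omega> \<phi> f u"
  proof (cases "F_lim \<Omega> \<phi> f u < top")
    case True
    then show ?thesis
      using ps by (intro recovery_sequence F_lim_recovery f u dense) auto
  next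
    case False
    then show ?thesis
      using u by (intro exI[of _ "\<lambda>_. u"]) (auto simp: L2_norm_def ennpow_0 less_top[symmetric])
  qed
qed

end

section \<open>From the structural hypotheses on \<open>\<phi>\<close> to uniform constants\<close>

lemma doubling_phi_exists:
  assumes "open \<Omega>" "bounded \<Omega>" "weak_Phi \<Omega> \<phi>" "A0 \<Omega> \<phi>" "Dec \<Omega> \<phi>"
  shows "\<exists>L q \<beta>. doubling_phi \<Omega> \<phi> L q \<beta>"
proof -
  obtain L where L: "1 \<le> L" "AE x in lebesgue_on \<Omega>.
        mono_on {0..} (\<phi> x) \<and> \<phi> x 0 = 0 \<and> (\<phi> x \<longlongrightarrow> 0) (at_right 0) \<and>
        (\<phi> x \<longlongrightarrow> \<infinity>) at_top \<and> almost_increasing L (\<lambda>t. \<phi> x t / ennreal t)"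
    using assms(3) unfolding weak_Phi_def by blast
  obtain \<beta> where b: "0 < \<beta>" "AE x in lebesgue_on \<Omega>. \<phi> x \<beta> \<le> 1 \<and> 1 \<le> \<phi> x (1 / \<beta>)"
    using assms(4) unfolding A0_def by blast
  obtain q where q: "1 < q" "AE x in lebesgue_on \<Omega>.
     (\<forall>s t. 0 < s \<and> s \<le> t \<longrightarrow> \<phi> x t / ennreal (t powr q) \<le> \<phi> x s / ennreal (s powr q))"
    using assms(5) unfolding Dec_def by blast
  have "AE x in lebesgue_on \<Omega>. doubling L q \<beta> (\<phi> x)"
    using L(2) b(2) q(2) by eventually_elim (intro doublingI L(1); blast)
  moreover have "(\<lambda>y. \<phi> y (h y)) \<in> borel_measurable (lebesgue_on \<Omega>)"
    if "h \<in> borel_measurable (lebesgue_on \<Omega>)" "\<And>y. 0 \<le> h y" for h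
    using assms(3) that unfolding weak_Phi_def by blast
  ultimately have "doubling_phi \<Omega> \<phi> L q \<beta>"
    using assms(1,2) L(1) b(1) q(1) by unfold_locales auto
  then show ?thesis by blast
qed

theorem theorem1p1:
  fixes \<Omega> :: "(real^'n::finite) set" and \<phi> :: "'n phi"
  assumes "open \<Omega>" and "bounded \<Omega>" and "connected \<Omega>" and "\<Omega> \<noteq> {}"
    and "weak_Phi \<Omega> \<phi>" and "A0 \<Omega> \<phi>" and "Dec \<Omega> \<phi>"
  shows
    "(\<forall>r u0. r > 1 \<and> L1phi \<Omega> (phi_pow \<phi> r) u0 \<longrightarrow>
        Gamma_conv {1<..<r} (L1 \<Omega>) (\<lambda>us u. (\<lambda>i. L1_norm \<Omega> (\<lambda>x. us i x - u x)) \<longlonglongrightarrow> 0)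
          (E_p \<Omega> \<phi> u0) (E_lim \<Omega> \<phi> u0))
   \<and> (\<forall>f. L2 \<Omega> f \<and>
        (\<forall>u. L1phi \<Omega> \<phi> u \<and> L2 \<Omega> u \<longrightarrow>
           (\<forall>\<epsilon>>0. \<exists>v. smooth_closure \<Omega> v \<and>
               L1phi_norm \<Omega> \<phi> (\<lambda>x. v x - u x) + L2_norm \<Omega> (\<lambda>x. v x - u x) < ennreal \<epsilon>))
      \<longrightarrow> Gamma_conv {1<..} (L2 \<Omega>) (\<lambda>us u. (\<lambda>i. L2_norm \<Omega> (\<lambda>x. us i x - u x)) \<longlonglongrightarrow> 0)
          (F_p \<Omega> \<phi> f) (F_lim \<Omega> \<phi> f))"
proof -
  obtain L q \<beta> where "doubling_phi \<Omega> \<phi> L q \<beta>"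
    using doubling_phi_exists[OF assms(1,2,5-7)] by blast
  then interpret doubling_phi \<Omega> \<phi> L q \<beta> .
  show ?thesis
    by (intro conjI allI impI; elim conjE) (auto intro: Gamma_conv_E Gamma_conv_F)
qed

end
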